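(* Consider the standard cylinder $Z=\mathbb D^2\times\mathbb R$ over the closed unit disc, as a billiard table in $\mathbb R^3$ with the standard contact structure $\xi_{\mathrm{std}}$ and metric $g_{\mathrm{std}}$. The $C^1$-gliding trajectories on $Z$ are exactly the helices of slope $1$ tangent to $\partial Z$, i.e., the leaves of the boundary foliation $\xi_{\mathrm{std}}\cap T\partial Z$.
   Context: On $\mathbb R^3$ let $\alpha=dz-\tfrac12(x\,dy-y\,dx)=dz-\tfrac12r^2d\theta$, $\xi_{\mathrm{std}}=\ker\alpha$, and $g_{\mathrm{std}}=dx^2+dy^2$ restricted to $\xi_{\mathrm{std}}$. Write covectors as $\lambda=a\alpha+b\,dx+c\,dy$; the maximised Hamiltonian (dual norm) is $H(\lambda)=\sqrt{b^2+c^2}$. Put $S=\{H=1\}$, $D=\{H\le1\}$, and let $\tau:T^*\mathbb R^3\to\mathbb R^3$ be the bundle projection. The microlocal realisation of the table is $B=S|_Z\cup D|_{\partial Z}\subset T^*\mathbb R^3$. Let $G$ be a smooth function on $\mathbb R^3$ (lifted to $T^*\mathbb R^3$) having $\partial Z$ as a regular level set, with sign such that the flow of its Hamiltonian vector field $X_G$ (fibrewise translation along $dG$) goes, within $D|_{\partial Z}$, from strictly outward to strictly inward pointing covectors of $S|_{\partial Z}$ (according to whether the unit vector of $\xi_{\mathrm{std}}$ maximising the covector points strictly out of or into $Z$). A billiard characteristic is a Lipschitz characteristic curve $\lambda:I\to B$ with $\dot\lambda$ equal almost everywhere to $X_H$ (in $S|_Z$) or $X_G$ (in $D|_{\partial Z}$).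 Its projection $\tau\circ\lambda$ is an unreduced billiard trajectory; the reparametrisation of the latter by arclength is a (reduced) billiard trajectory. A curve $\gamma:I\to Z$ is a limit trajectory if it is a $C^0_{loc}$-limit of (reduced) billiard trajectories. It is a $C^1$-limit trajectory if, for some approximating sequence $\gamma_i$ of billiard trajectories, the corresponding billiard characteristics $\lambda_i$ converge in $C^0_{loc}$ to a cotangent lift $\lambda$ of $\gamma$, i.e. to a curve $\lambda$ in $T^*\mathbb R^3$ projecting to $\gamma$ (here $\lambda_i$ and $\lambda$ carry the parametrisation of billiard characteristics, so their projections are the unreduced versions of $\gamma_i$ and $\gamma$). A $C^1$-limit trajectory with $\gamma(I)\subseteq\partial Z$ is called a $C^1$-gliding trajectory.
   Formalization: With α = dz − ½r²dθ the boundary leaves satisfy dz = ½dθ, so their ordinary slope is 1/2, and "slope 1" read literally contradicts "leaves of the boundary foliation"; slope 1 is taken to mean z = z₀ + θ/2, the actual leaves. *)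

theory Defs
  imports "HOL-Analysis.Analysis"
begin

section \<open>The contact structure, its metric and the table\<close>

definition alpha :: "real^3 \<Rightarrow> real^3 \<Rightarrow> real" where
  "alpha q v = v$3 - (q$1 * v$2 - q$2 * v$1) / 2"

definition xi :: "real^3 \<Rightarrow> (real^3) set" where
  "xi q = {v. alpha q v = 0}"

text \<open>The norm of \<open>dx\<^sup>2 + dy\<^sup>2\<close>; it is only ever applied to vectors of \<^const>\<open>xi\<close>.\<close>

definition gnorm :: "real^3 \<Rightarrow> real" where
  "gnorm v = sqrt ((v$1)\<^sup>2 + (v$2)\<^sup>2)"

definition Z :: "(real^3) set" where
  "Z = {q. (q$1)\<^sup>2 + (q$2)\<^sup>2 \<le> 1}"

text \<open>The tangent plane at \<open>q\<close> of the level set of \<open>x\<^sup>2 + y\<^sup>2\<close> through \<open>q\<close>; used for \<open>q\<close> in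
  \<open>frontier Z\<close>.  The two predicates below it are the corresponding open half spaces.\<close>

definition T_bdry :: "real^3 \<Rightarrow> (real^3) set" where
  "T_bdry q = {v. q$1 * v$1 + q$2 * v$2 = 0}"

definition points_out :: "real^3 \<Rightarrow> real^3 \<Rightarrow> bool" where
  "points_out q v \<longleftrightarrow> q$1 * v$1 + q$2 * v$2 > 0"

definition points_in :: "real^3 \<Rightarrow> real^3 \<Rightarrow> bool" where
  "points_in q v \<longleftrightarrow> q$1 * v$1 + q$2 * v$2 < 0"

section \<open>Hamiltonians on the cotangent bundle\<close>

text \<open>A covector is a pair \<open>(q, p)\<close>, where \<open>p\<close> holds the canonical momenta: it sends the vector \<open>v\<close>
  at \<open>q\<close> to \<open>p \<bullet> v\<close>.  The bundle projection is \<^const>\<open>fst\<close>.\<close>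

type_synonym cotangent = "(real^3) \<times> (real^3)"

definition coeff_a :: "cotangent \<Rightarrow> real" where
  "coeff_a l = snd l $ 3"

definition coeff_b :: "cotangent \<Rightarrow> real" where
  "coeff_b l = snd l $ 1 - fst l $ 2 * coeff_a l / 2"

definition coeff_c :: "cotangent \<Rightarrow> real" where
  "coeff_c l = snd l $ 2 + fst l $ 1 * coeff_a l / 2"

lemma covector_decomposition:
  "p \<bullet> v = coeff_a (q, p) * alpha q v + coeff_b (q, p) * v$1 + coeff_c (q, p) * v$2"
  by (simp add: inner_vec_def sum_3 alpha_def coeff_a_def coeff_b_def coeff_c_def field_simps)

definition H :: "cotangent \<Rightarrow> real" where
  "H l = sqrt ((coeff_b l)\<^sup>2 + (coeff_c l)\<^sup>2)"

definition S_over :: "(real^3) set \<Rightarrow> cotangent set" where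
  "S_over A = {l. H l = 1 \<and> fst l \<in> A}"

definition D_over :: "(real^3) set \<Rightarrow> cotangent set" where
  "D_over A = {l. H l \<le> 1 \<and> fst l \<in> A}"

definition B :: "cotangent set" where
  "B = S_over Z \<union> D_over (frontier Z)"

text \<open>Hamilton's equations \<open>q' = \<partial>F/\<partial>p\<close>, \<open>p' = - \<partial>F/\<partial>q\<close>.  With this sign the flow of \<^const>\<open>H\<close> moves
  in the direction that maximises the covector.\<close>

definition ham_vf :: "(cotangent \<Rightarrow> real) \<Rightarrow> cotangent \<Rightarrow> cotangent" where
  "ham_vf F l = (\<chi> i. frechet_derivative F (at l) (0, axis i 1),
                 \<chi> i. - frechet_derivative F (at l) (axis i 1, 0))"

definition maximises :: "cotangent \<Rightarrow> real^3 \<Rightarrow> bool" where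
  "maximises l v \<longleftrightarrow> v \<in> xi (fst l) \<and> gnorm v = 1 \<and>
     (\<forall>w \<in> xi (fst l). gnorm w = 1 \<longrightarrow> snd l \<bullet> w \<le> snd l \<bullet> v)"

definition strictly_outward :: "cotangent \<Rightarrow> bool" where
  "strictly_outward l \<longleftrightarrow> (\<exists>v. maximises l v \<and> points_out (fst l) v)"

definition strictly_inward :: "cotangent \<Rightarrow> bool" where
  "strictly_inward l \<longleftrightarrow> (\<exists>v. maximises l v \<and> points_in (fst l) v)"

primrec Ck :: "nat \<Rightarrow> (real^3 \<Rightarrow> real) \<Rightarrow> bool" where
  "Ck 0 f \<longleftrightarrow> continuous_on UNIV f"
| "Ck (Suc k) f \<longleftrightarrow> (\<forall>q. f differentiable (at q)) \<and>
     (\<forall>v. Ck k (\<lambda>q. frechet_derivative f (at q) v))"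

text \<open>The last conjunct is the sign convention: a nondegenerate flow line of \<open>X_G\<close> that stays in
  \<open>D\<close> and has both ends on \<open>S\<close> starts outward and finishes inward.\<close>

definition table_hamiltonian :: "(real^3 \<Rightarrow> real) \<Rightarrow> bool" where
  "table_hamiltonian G \<longleftrightarrow>
     (\<forall>k. Ck k G) \<and>
     (\<exists>c. frontier Z = {q. G q = c}) \<and>
     (\<forall>q \<in> frontier Z. frechet_derivative G (at q) \<noteq> (\<lambda>v. 0)) \<and>
     (\<forall>mu T. 0 < T \<longrightarrow> mu ` {0..T} \<subseteq> D_over (frontier Z) \<longrightarrow>
        (\<forall>t \<in> {0..T}. (mu has_vector_derivative ham_vf (G \<circ> fst) (mu t)) (at t within {0..T})) \<longrightarrow>
        mu 0 \<in> S_over (frontier Z) \<longrightarrow> mu T \<in> S_over (frontier Z) \<longrightarrow>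
        strictly_outward (mu 0) \<and> strictly_inward (mu T))"

section \<open>Billiard trajectories\<close>

text \<open>A curve is a function on \<open>real\<close> together with its domain, an interval that may be open or
  closed, bounded or unbounded; values off the domain are irrelevant.\<close>

definition curve_domain :: "real set \<Rightarrow> bool" where
  "curve_domain I \<longleftrightarrow> is_interval I \<and> interior I \<noteq> {}"

definition billiard_characteristic ::
    "(real^3 \<Rightarrow> real) \<Rightarrow> real set \<Rightarrow> (real \<Rightarrow> cotangent) \<Rightarrow> bool" where
  "billiard_characteristic G J lam \<longleftrightarrow>
     curve_domain J \<and> lam ` J \<subseteq> B \<and> (\<exists>C. C-lipschitz_on J lam) \<and>
     (AE t in lebesgue. t \<in> J \<longrightarrow>
        lam t \<in> S_over Z \<and> (lam has_vector_derivative ham_vf H (lam t)) (at t within J) \<or>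
        lam t \<in> D_over (frontier Z) \<and>
          (lam has_vector_derivative ham_vf (G \<circ> fst) (lam t)) (at t within J))"

definition arclength :: "(real \<Rightarrow> real^3) \<Rightarrow> real \<Rightarrow> real \<Rightarrow> real" where
  "arclength c s t = integral {s..t} (\<lambda>u. gnorm (vector_derivative c (at u)))"

text \<open>\<open>gam\<close>, on \<open>I\<close>, is the reparametrisation by arclength of \<open>c\<close>, on \<open>J\<close>; the time change \<open>sig\<close>
  sends the old parameter to the new one.  It is constant wherever \<open>c\<close> stands still, i.e. along
  \<open>X_G\<close>, so it need not be invertible.\<close>

definition arclength_reparam ::
    "real set \<Rightarrow> (real \<Rightarrow> real^3) \<Rightarrow> real set \<Rightarrow> (real \<Rightarrow> real^3) \<Rightarrow> (real \<Rightarrow> real) \<Rightarrow> bool" where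
  "arclength_reparam J c I gam sig \<longleftrightarrow>
     sig ` J = I \<and> (\<forall>t \<in> J. c t = gam (sig t)) \<and>
     (\<forall>s \<in> J. \<forall>t \<in> J. s \<le> t \<longrightarrow> sig t - sig s = arclength c s t)"

definition reduces_to ::
    "(real^3 \<Rightarrow> real) \<Rightarrow> real set \<Rightarrow> (real \<Rightarrow> cotangent) \<Rightarrow>
     real set \<Rightarrow> (real \<Rightarrow> real^3) \<Rightarrow> (real \<Rightarrow> real) \<Rightarrow> bool" where
  "reduces_to G J lam I gam sig \<longleftrightarrow>
     billiard_characteristic G J lam \<and> arclength_reparam J (fst \<circ> lam) I gam sig"

definition billiard_trajectory ::
    "(real^3 \<Rightarrow> real) \<Rightarrow> real set \<Rightarrow> (real \<Rightarrow> real^3) \<Rightarrow> bool" where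
  "billiard_trajectory G I gam \<longleftrightarrow> (\<exists>J lam sig. reduces_to G J lam I gam sig)"

section \<open>Limits\<close>

text \<open>Convergence in \<open>C\<^sup>0\<close>, locally, of curves whose domains may vary with \<open>n\<close>: characteristics
  with the same reduced domain have, in general, different unreduced ones.  The behaviour at end
  points of \<open>I\<close> is determined by continuity of the limit.\<close>

definition C0_loc_converges ::
    "(nat \<Rightarrow> real set) \<Rightarrow> (nat \<Rightarrow> real \<Rightarrow> 'a::metric_space) \<Rightarrow> real set \<Rightarrow> (real \<Rightarrow> 'a) \<Rightarrow> bool" where
  "C0_loc_converges In f I g \<longleftrightarrow> continuous_on I g \<and>
     (\<forall>K. compact K \<longrightarrow> K \<subseteq> interior I \<longrightarrow>
        (\<forall>\<^sub>F n in sequentially. K \<subseteq> In n) \<and> uniform_limit K f g sequentially)"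

definition limit_trajectory ::
    "(real^3 \<Rightarrow> real) \<Rightarrow> real set \<Rightarrow> (real \<Rightarrow> real^3) \<Rightarrow> bool" where
  "limit_trajectory G I gam \<longleftrightarrow> curve_domain I \<and> gam ` I \<subseteq> Z \<and>
     (\<exists>In gamn. (\<forall>n. billiard_trajectory G (In n) (gamn n)) \<and> C0_loc_converges In gamn I gam)"

text \<open>The limit \<open>lam\<close> of the characteristics projects to the unreduced version \<open>gam \<circ> sig\<close> of \<open>gam\<close>,
  where the time change \<open>sig\<close> is the limit of the time changes of the approximating trajectories.\<close>

definition C1_limit_trajectory ::
    "(real^3 \<Rightarrow> real) \<Rightarrow> real set \<Rightarrow> (real \<Rightarrow> real^3) \<Rightarrow> bool" where
  "C1_limit_trajectory G I gam \<longleftrightarrow> curve_domain I \<and> gam ` I \<subseteq> Z \<and>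
     (\<exists>In gamn Jn lamn sign J lam sig.
        (\<forall>n. reduces_to G (Jn n) (lamn n) (In n) (gamn n) (sign n)) \<and>
        C0_loc_converges In gamn I gam \<and>
        curve_domain J \<and>
        C0_loc_converges Jn lamn J lam \<and>
        C0_loc_converges Jn sign J sig \<and>
        mono_on J sig \<and> sig ` J = I \<and>
        (\<forall>t \<in> J. fst (lam t) = gam (sig t)))"

lemma C1_limit_trajectory_imp_limit_trajectory:
  "C1_limit_trajectory G I gam \<Longrightarrow> limit_trajectory G I gam"
  unfolding C1_limit_trajectory_def limit_trajectory_def billiard_trajectory_def by metis

definition C1_gliding_trajectory ::
    "(real^3 \<Rightarrow> real) \<Rightarrow> real set \<Rightarrow> (real \<Rightarrow> real^3) \<Rightarrow> bool" where
  "C1_gliding_trajectory G I gam \<longleftrightarrow> C1_limit_trajectory G I gam \<and> gam ` I \<subseteq> frontier Z"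

section \<open>The boundary foliation\<close>

definition leaf_through :: "real^3 \<Rightarrow> (real^3) set" where
  "leaf_through q = {q'. \<exists>c c'. c 0 = q \<and> c 1 = q' \<and> c ` {0..1::real} \<subseteq> frontier Z \<and>
     continuous_on {0..1} c' \<and>
     (\<forall>t \<in> {0..1}. (c has_vector_derivative c' t) (at t within {0..1}) \<and>
                   c' t \<in> xi (c t) \<inter> T_bdry (c t))}"

definition boundary_leaves :: "(real^3) set set" where
  "boundary_leaves = leaf_through ` frontier Z"

text \<open>Slope is height gained per area swept out in the \<open>xy\<close>-plane, \<open>dz = m \<cdot> \<half> r\<^sup>2 d\<theta>\<close>; the Euclidean
  slope of such a helix on the unit cylinder is \<open>m/2\<close>.\<close>

definition helix :: "real \<Rightarrow> real \<Rightarrow> (real^3) set" where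
  "helix m z0 = range (\<lambda>\<theta>::real. vector [cos \<theta>, sin \<theta>, z0 + m * (\<theta> / 2)])"

text \<open>\<open>gam\<close> traverses (an arc of) \<open>L\<close> at unit speed, without turning back.\<close>

definition unit_speed_arc :: "(real^3) set \<Rightarrow> real set \<Rightarrow> (real \<Rightarrow> real^3) \<Rightarrow> bool" where
  "unit_speed_arc L I gam \<longleftrightarrow> gam ` I \<subseteq> L \<and>
     (\<exists>gam'. continuous_on I gam' \<and>
        (\<forall>s \<in> I. (gam has_vector_derivative gam' s) (at s within I) \<and>
                  gam' s \<in> xi (gam s) \<and> gnorm (gam' s) = 1))"

end

theory Submission
  imports Defs
begin

text \<open>Along a billiard characteristic the arclength \<open>\<sigma>\<close> grows at rate \<open>1\<close> in the \<open>X\<^sub>H\<close>-phases and at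
  rate \<open>0\<close> in the \<open>X\<^sub>G\<close>-phases.  Hence every function \<open>\<phi>\<close> that is constant along \<open>X\<^sub>G\<close> satisfies
  \<open>d\<phi> = d\<phi>(X\<^sub>H) d\<sigma>\<close>, and this relation survives in a \<open>C\<^sup>1\<close>-limit, where the phases are no longer
  visible.  Write \<open>\<nu>\<close> and \<open>\<tau>\<close> for the normal and tangential parts of \<open>(b, c)\<close>, so that
  \<open>\<nu>\<^sup>2 + \<tau>\<^sup>2 = H\<^sup>2 \<le> 1\<close> over the boundary.  For a limit lying over the boundary,
  \<open>\<phi> = x\<^sup>2 + y\<^sup>2\<close> gives \<open>\<nu> d\<sigma> = 0\<close>, and then \<open>\<phi> = \<tau>\<close> gives \<open>d\<tau> = a \<nu> d\<sigma> = 0\<close>, so \<open>\<tau>\<close> is constant.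
  If \<open>\<tau>\<^sup>2 < 1\<close>, then at each time \<open>H < 1\<close> (only \<open>X\<^sub>G\<close>-phases nearby) or \<open>\<nu> \<noteq> 0\<close>; in both cases
  \<open>d\<sigma> = 0\<close> and the limit stands still.  So \<open>\<tau> = \<plusminus>1\<close> and \<open>\<nu> = 0\<close>, and \<open>\<phi> = x, y, z\<close> yield the
  equations of a helix.  Conversely, each helix lifts to a single \<open>X\<^sub>H\<close>-trajectory.\<close>

section \<open>The Hamiltonian vector fields\<close>

lemma frontier_Z: "frontier Z = {q. (q$1)\<^sup>2 + (q$2)\<^sup>2 = 1}"
proof -
  have "closed Z"
    unfolding Z_def by (intro closed_Collect_le continuous_intros)
  moreover have "interior Z = {q. (q$1)\<^sup>2 + (q$2)\<^sup>2 < 1}"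
  proof
    have "open {q :: real^3. (q$1)\<^sup>2 + (q$2)\<^sup>2 < 1}"
      by (intro open_Collect_less continuous_intros)
    then show "{q. (q$1)\<^sup>2 + (q$2)\<^sup>2 < 1} \<subseteq> interior Z"
      by (intro interior_maximal) (auto simp: Z_def)
    show "interior Z \<subseteq> {q. (q$1)\<^sup>2 + (q$2)\<^sup>2 < 1}"
    proof
      fix q assume q: "q \<in> interior Z"
      \<comment> \<open>An interior point stays in \<open>Z\<close> after radial scaling by some
        factor \<open>1 + e > 1\<close>, which forces its radius strictly below 1.\<close>
      have lim: "((\<lambda>e. (1 + e) *\<^sub>R q) \<longlongrightarrow> (1 + 0) *\<^sub>R q) (at_right 0)"
        by (intro tendsto_intros)
      have "\<forall>\<^sub>F e in at_right 0. (1 + e) *\<^sub>R q \<in> interior Z"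
        using lim q by (intro topological_tendstoD[OF lim]) auto
      then have "\<forall>\<^sub>F e in at_right 0. (1 + e) *\<^sub>R q \<in> interior Z \<and> e > (0::real)"
        using eventually_at_right_less by (rule eventually_conj)
      then obtain e where e: "e > 0" "(1 + e) *\<^sub>R q \<in> interior Z"
        using eventually_happens'[OF trivial_limit_at_right_real] by blast
      then have "(1 + e)\<^sup>2 * ((q$1)\<^sup>2 + (q$2)\<^sup>2) \<le> 1"
        using subsetD[OF interior_subset e(2)]
        by (simp add: Z_def power_mult_distrib distrib_left)
      moreover have "(1 + e)\<^sup>2 > 1"
        using e by (simp add: one_less_power)
      ultimately have "(q$1)\<^sup>2 + (q$2)\<^sup>2 < 1"
        by (smt (verit) mult_le_cancel_left1 mult_less_cancel_right2 sum_power2_ge_zero)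
      then show "q \<in> {q. (q$1)\<^sup>2 + (q$2)\<^sup>2 < 1}" by simp
    qed
  qed
  ultimately show ?thesis
    by (auto simp: frontier_def Z_def)
qed

lemma has_derivative_fst_nth: "((\<lambda>l :: cotangent. fst l $ i) has_derivative (\<lambda>d. fst d $ i)) F"
  by (intro bounded_linear_imp_has_derivative bounded_linear_compose[OF bounded_linear_vec_nth]
    bounded_linear_fst)

lemma has_derivative_snd_nth: "((\<lambda>l :: cotangent. snd l $ i) has_derivative (\<lambda>d. snd d $ i)) F"
  by (intro bounded_linear_imp_has_derivative bounded_linear_compose[OF bounded_linear_vec_nth]
    bounded_linear_snd)

lemma ham_vf_eqI:
  assumes "(F has_derivative F') (at l)"
  shows "ham_vf F l = (\<chi> i. F' (0, axis i 1), \<chi> i. - F' (axis i 1, 0))"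
  by (simp add: ham_vf_def frechet_derivative_at[OF assms, symmetric])

lemma H_power2: "(H l)\<^sup>2 = (coeff_b l)\<^sup>2 + (coeff_c l)\<^sup>2"
  by (simp add: H_def)

text \<open>On \<open>H = 1\<close> the derivative of the square root is simply
  \<open>b db + c dc\<close>. The flow fixes \<open>a\<close> and rotates \<open>(b, c)\<close> with
  angular speed \<open>a\<close>, so that trajectories project to circles or lines in the plane; the
  third base component keeps the velocity in \<open>xi\<close>.\<close>

lemma ham_vf_H:
  assumes "H l = 1"
  shows "ham_vf H l =
    (vector [coeff_b l, coeff_c l, (fst l $ 1 * coeff_c l - fst l $ 2 * coeff_b l) / 2],
     vector [- coeff_c l * coeff_a l / 2, coeff_b l * coeff_a l / 2, 0])"
proof -
  let ?b = "\<lambda>d :: cotangent. snd d $ 1 - (fst d $ 2 * snd l $ 3 + fst l $ 2 * snd d $ 3) / 2"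
  let ?c = "\<lambda>d :: cotangent. snd d $ 2 + (fst d $ 1 * snd l $ 3 + fst l $ 1 * snd d $ 3) / 2"
  have b: "(coeff_b has_derivative ?b) (at l)"
    unfolding coeff_b_def[abs_def] coeff_a_def
    by (auto intro!: derivative_eq_intros has_derivative_fst_nth has_derivative_snd_nth simp: algebra_simps)
  have c: "(coeff_c has_derivative ?c) (at l)"
    unfolding coeff_c_def[abs_def] coeff_a_def
    by (auto intro!: derivative_eq_intros has_derivative_fst_nth has_derivative_snd_nth simp: algebra_simps add_divide_distrib)
  have sq: "((\<lambda>l. (coeff_b l)\<^sup>2 + (coeff_c l)\<^sup>2) has_derivative
      (\<lambda>d. 2 * coeff_b l * ?b d + 2 * coeff_c l * ?c d)) (at l)"
    by (rule derivative_eq_intros b c refl)+ (auto simp: algebra_simps)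
  have 1: "(coeff_b l)\<^sup>2 + (coeff_c l)\<^sup>2 = 1"
    using assms by (simp flip: H_power2)
  have "(H has_derivative (\<lambda>d. coeff_b l * ?b d + coeff_c l * ?c d)) (at l)"
    unfolding H_def[abs_def]
    by (rule has_derivative_eq_rhs[OF has_derivative_real_sqrt[OF _ sq]])
      (auto simp: 1 field_simps)
  from ham_vf_eqI[OF this] show ?thesis
    by (simp add: vec_eq_iff forall_3 axis_def coeff_a_def field_simps)
qed

lemma has_real_derivative_const_on:
  assumes "(f has_real_derivative D) (at (s::real))" "\<And>t. f t = (k::real)"
  shows "D = 0"
proof -
  have "f = (\<lambda>_. k)" using assms(2) by auto
  then show ?thesis using assms(1) DERIV_unique DERIV_const by metis
qed

text \<open>The level set condition forces \<open>dG\<close> to annihilate the tangent plane of the cylinder, so that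
  \<open>X\<^sub>G\<close> fixes both \<open>a\<close> and the tangential part of \<open>(b, c)\<close>.\<close>

lemma ham_vf_table_hamiltonian:
  assumes G: "table_hamiltonian G" and l: "fst l \<in> frontier Z"
  shows "fst (ham_vf (G \<circ> fst) l) = 0"
    and "snd (ham_vf (G \<circ> fst) l) $ 3 = 0"
    and "fst l $ 1 * snd (ham_vf (G \<circ> fst) l) $ 2 = fst l $ 2 * snd (ham_vf (G \<circ> fst) l) $ 1"
proof -
  define q where "q = fst l"
  have q: "(q$1)\<^sup>2 + (q$2)\<^sup>2 = 1" using l by (simp add: frontier_Z q_def)
  have "Ck (Suc 0) G" using G by (simp only: table_hamiltonian_def)
  then have "G differentiable (at q)" by simp
  then obtain G' where G': "(G has_derivative G') (at q)"
    by (auto simp: differentiable_def)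
  then have lin: "linear G'"
    using has_derivative_linear by blast
  obtain k where k: "\<And>p. (p$1)\<^sup>2 + (p$2)\<^sup>2 = 1 \<Longrightarrow> G p = k"
  proof -
    obtain k where "frontier Z = {q. G q = k}"
      using G unfolding table_hamiltonian_def by blast
    then have "G p = k" if "(p$1)\<^sup>2 + (p$2)\<^sup>2 = 1" for p
      using that unfolding frontier_Z by blast
    then show ?thesis using that by blast
  qed
  have "((G \<circ> fst) has_derivative (\<lambda>d. G' (fst d))) (at l)"
    unfolding comp_def
    by (rule has_derivative_compose[where f=fst and g=G, simplified comp_def])
      (use G' in \<open>auto simp: q_def intro!: derivative_eq_intros\<close>)
  note vf = ham_vf_eqI[OF this]
  show "fst (ham_vf (G \<circ> fst) l) = 0"
    by (simp add: vf linear_0[OF lin] vec_eq_iff)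
  \<comment> \<open>\<open>G\<close> is constant along any curve in the cylinder, so its
    differential kills the velocity. A vertical line and a rotation supply two velocities that span
    the tangent plane.\<close>
  have along: "G' v = 0"
    if c: "(c has_vector_derivative v) (at 0)" "c 0 = q" "\<And>t. (c t $ 1)\<^sup>2 + (c t $ 2)\<^sup>2 = 1"
    for c :: "real \<Rightarrow> real^3" and v
  proof -
    have "((\<lambda>t. G (c t)) has_derivative (\<lambda>t. G' (t *\<^sub>R v))) (at 0)"
      using has_derivative_compose[of c "\<lambda>t. t *\<^sub>R v" 0 UNIV G G'] c(1,2) G'
      by (simp add: has_vector_derivative_def)
    then have "((\<lambda>t. G (c t)) has_real_derivative G' v) (at 0)"
      by (simp add: has_field_derivative_def linear_cmul[OF lin] mult.commute[of _ "G' v"])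
    then show ?thesis
      by (rule has_real_derivative_const_on) (use c k in auto)
  qed
  have "G' (axis 3 1) = 0"
  proof (rule along)
    show "((\<lambda>t. q + t *\<^sub>R axis 3 1) has_vector_derivative axis 3 1) (at 0)"
      by (auto intro!: derivative_eq_intros)
  qed (use q in \<open>auto simp: axis_def\<close>)
  then show "snd (ham_vf (G \<circ> fst) l) $ 3 = 0"
    by (simp add: vf)
  have rot: "G' (q$1 *\<^sub>R axis 2 1 - q$2 *\<^sub>R axis 1 1) = 0"
  proof (rule along)
    \<comment> \<open>Rotation of \<open>q\<close> about the axis of the cylinder, at constant
      height.\<close>
    let ?c = "\<lambda>t. cos t *\<^sub>R (q$1 *\<^sub>R axis 1 1 + q$2 *\<^sub>R axis 2 1)
      + sin t *\<^sub>R (q$1 *\<^sub>R axis 2 1 - q$2 *\<^sub>R axis 1 1) + q$3 *\<^sub>R axis 3 1 :: real^3"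
    have "(?c has_vector_derivative (- sin 0) *\<^sub>R (q$1 *\<^sub>R axis 1 1 + q$2 *\<^sub>R axis 2 1)
      + cos 0 *\<^sub>R (q$1 *\<^sub>R axis 2 1 - q$2 *\<^sub>R axis 1 1)) (at 0)"
      by (rule derivative_eq_intros DERIV_sin DERIV_cos refl | simp)+
    then show "(?c has_vector_derivative (q$1 *\<^sub>R axis 2 1 - q$2 *\<^sub>R axis 1 1)) (at 0)"
      by simp
    show "?c 0 = q" by (simp add: vec_eq_iff forall_3 axis_def)
    show "(?c t $ 1)\<^sup>2 + (?c t $ 2)\<^sup>2 = 1" for t
    proof -
      have "(cos t * q$1 - sin t * q$2)\<^sup>2 + (cos t * q$2 + sin t * q$1)\<^sup>2
        = ((sin t)\<^sup>2 + (cos t)\<^sup>2) * ((q$1)\<^sup>2 + (q$2)\<^sup>2)"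
        by algebra
      then show ?thesis using q by (simp add: axis_def)
    qed
  qed
  then have "q$1 * G' (axis 2 1) = q$2 * G' (axis 1 1)"
    by (simp add: linear_diff[OF lin] linear_cmul[OF lin])
  then show "fst l $ 1 * snd (ham_vf (G \<circ> fst) l) $ 2 = fst l $ 2 * snd (ham_vf (G \<circ> fst) l) $ 1"
    by (simp add: vf q_def)
qed

section \<open>Integration along characteristics\<close>

text \<open>The difference quotients of \<open>f\<close> are bounded by the Lipschitz constant and
  converge almost everywhere to \<open>f'\<close>. Their integrals are differences of difference
  quotients of an antiderivative of \<open>f\<close>, and these tend to \<open>f t - f s\<close>;
  dominated convergence joins the two limits.\<close>

lemma lipschitz_fundamental_theorem:
  fixes f f' :: "real \<Rightarrow> real"
  assumes lip: "C-lipschitz_on {s..t} f" and "s \<le> t" and N: "negligible N"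
    and f': "\<And>u. s < u \<Longrightarrow> u < t \<Longrightarrow> u \<notin> N \<Longrightarrow> (f has_real_derivative f' u) (at u)"
  shows "(f' has_integral f t - f s) {s..t}"
proof -
  \<comment> \<open>Clamping the argument extends \<open>f\<close> by constants with the same
    Lipschitz constant, so that quotients reaching beyond \<open>t\<close> make sense.\<close>
  define F where "F u = f (max s (min t u))" for u
  have C: "0 \<le> C" using lip lipschitz_on_nonneg by blast
  have F_lip: "\<bar>F u - F v\<bar> \<le> C * \<bar>u - v\<bar>" for u v
  proof -
    have "\<bar>F u - F v\<bar> \<le> C * \<bar>max s (min t u) - max s (min t v)\<bar>"
      unfolding F_def using lipschitz_onD[OF lip, of "max s (min t u)" "max s (min t v)"] \<open>s \<le> t\<close>
      by (auto simp: dist_real_def)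
    also have "\<dots> \<le> C * \<bar>u - v\<bar>"
      by (intro mult_left_mono C) auto
    finally show ?thesis .
  qed
  have F_eq: "F u = f u" if "s \<le> u" "u \<le> t" for u
    using that by (simp add: F_def)
  have "C-lipschitz_on UNIV F"
    by (rule lipschitz_onI) (auto simp: dist_real_def F_lip C)
  then have F_cont: "continuous_on A F" for A
    using lipschitz_on_continuous_on continuous_on_subset by blast
  \<comment> \<open>The margins make \<open>P\<close> differentiable in the two-sided sense on
    \<open>[s, t + 1]\<close>, which contains every \<open>u + h n\<close> because
    \<open>h n \<le> 1\<close>.\<close>
  obtain P where P': "\<And>u. u \<in> {s-1..t+2} \<Longrightarrow> (P has_vector_derivative F u) (at u within {s-1..t+2})"
    using antiderivative_continuous[OF F_cont] by blast
  have P: "(P has_real_derivative F u) (at u)" if "s \<le> u" "u \<le> t + 1" for u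
    using P'[of u] that
    by (simp add: at_within_Icc_at has_real_derivative_iff_has_vector_derivative)
  define h where "h n = 1 / real (Suc n)" for n
  have h: "0 < h n" "h n \<le> 1" for n by (auto simp: h_def)
  have h0: "h \<longlonglongrightarrow> 0" unfolding h_def by (rule LIMSEQ_Suc[OF lim_1_over_n])
  have h_at: "filterlim h (at 0) sequentially"
    using h0 h(1) by (auto simp: filterlim_at less_imp_neq[symmetric])
  \<comment> \<open>The endpoints join the null set since \<open>f'\<close> is a derivative only in
    between. Setting \<open>k\<close> and \<open>g\<close> to 0 on \<open>M\<close> makes the
    convergence hold at every point.\<close>
  define M where "M = N \<union> {s, t}"
  have M: "negligible M" by (simp add: M_def N)
  define k where "k n u = (if u \<in> M then 0 else (F (u + h n) - F u) / h n)" for n u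
  define g where "g u = (if u \<in> M then 0 else f' u)" for u
  have quot: "(\<lambda>n. (p (u + h n) - p u) / h n) \<longlonglongrightarrow> d"
    if "(p has_real_derivative d) (at u)" for p d and u :: real
    using that h_at unfolding DERIV_def by (rule filterlim_compose)
  have "(g has_integral F t - F s) {s..t}"
  proof (rule has_integral_dominated_convergence)
    fix n
    have "((\<lambda>u. (F (u + h n) - F u) / h n) has_integral
        (P (t + h n) - P t) / h n - (P (s + h n) - P s) / h n) {s..t}"
    proof -
      have "((\<lambda>u. (P (u + h n) - P u) / h n) has_real_derivative (F (u + h n) - F u) / h n) (at u)"
        if "u \<in> {s..t}" for u
      proof -
        have "((\<lambda>u. P (u + h n)) has_real_derivative F (u + h n)) (at u)"
          using P[of "u + h n"] h[of n] that by (simp add: DERIV_shift)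
        then show ?thesis
          using P[of u] that by (intro derivative_intros DERIV_diff DERIV_cdivide) auto
      qed
      then have "((\<lambda>u. (F (u + h n) - F u) / h n) has_integral
          (P (t + h n) - P t) / h n - (P (s + h n) - P s) / h n) {s..t}"
        by (intro fundamental_theorem_of_calculus \<open>s \<le> t\<close>)
          (auto simp: has_real_derivative_iff_has_vector_derivative[symmetric]
            intro: has_field_derivative_at_within)
      then show ?thesis by simp
    qed
    then show "(k n has_integral (P (t + h n) - P t) / h n - (P (s + h n) - P s) / h n) {s..t}"
      by (rule has_integral_spike[OF M, rotated]) (simp add: k_def)
    show "\<forall>u\<in>{s..t}. norm (k n u) \<le> C"
    proof
      fix u
      show "norm (k n u) \<le> C"
        using F_lip[of "u + h n" u] h[of n] C by (auto simp: k_def field_simps)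
    qed
  next
    show "(\<lambda>_. C) integrable_on {s..t}" by (rule integrable_const_ivl)
    show "\<forall>u\<in>{s..t}. (\<lambda>n. k n u) \<longlonglongrightarrow> g u"
    proof
      fix u assume u: "u \<in> {s..t}"
      show "(\<lambda>n. k n u) \<longlonglongrightarrow> g u"
      proof (cases "u \<in> M")
        case False
        then have "u \<in> {s<..<t}" "u \<notin> N" using u by (auto simp: M_def)
        moreover have "(F has_real_derivative f' u) (at u)"
          by (rule has_field_derivative_transform_within_open[OF f' open_greaterThanLessThan])
            (use calculation in \<open>auto simp: F_eq\<close>)
        ultimately show ?thesis using quot False by (simp add: k_def g_def)
      qed (simp add: k_def g_def)
    qed
    show "(\<lambda>n. (P (t + h n) - P t) / h n - (P (s + h n) - P s) / h n) \<longlonglongrightarrow> F t - F s"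
      by (intro tendsto_diff quot P) (use \<open>s \<le> t\<close> in auto)
  qed
  then have "(f' has_integral F t - F s) {s..t}"
    by (rule has_integral_spike[OF M, rotated]) (simp add: g_def)
  then show ?thesis using \<open>s \<le> t\<close> by (simp add: F_eq)
qed

lemma lipschitz_on_mult_Icc:
  fixes f g :: "real \<Rightarrow> real"
  assumes f: "C-lipschitz_on {s..t} f" and g: "D-lipschitz_on {s..t} g"
  shows "\<exists>E. E-lipschitz_on {s..t} (\<lambda>u. f u * g u)"
proof -
  have bound: "\<exists>K. \<forall>u\<in>{s..t}. \<bar>k u\<bar> \<le> K" if "L-lipschitz_on {s..t} k"
    for k :: "real \<Rightarrow> real" and L
  proof -
    have "bounded (k ` {s..t})"
      using lipschitz_on_continuous_on[OF that]
      by (intro compact_imp_bounded compact_continuous_image) auto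
    then show ?thesis by (auto simp: bounded_iff)
  qed
  obtain K where K: "\<And>u. u \<in> {s..t} \<Longrightarrow> \<bar>f u\<bar> \<le> K" using bound[OF f] by blast
  obtain M where M: "\<And>u. u \<in> {s..t} \<Longrightarrow> \<bar>g u\<bar> \<le> M" using bound[OF g] by blast
  have C: "0 \<le> C" "0 \<le> D" using f g lipschitz_on_nonneg by blast+
  have "(\<bar>K\<bar> * D + \<bar>M\<bar> * C)-lipschitz_on {s..t} (\<lambda>u. f u * g u)"
  proof (rule lipschitz_onI)
    fix u v assume uv: "u \<in> {s..t}" "v \<in> {s..t}"
    have "\<bar>f u * g u - f v * g v\<bar> = \<bar>f u * (g u - g v) + g v * (f u - f v)\<bar>"
      by (simp add: algebra_simps)
    also have "\<dots> \<le> \<bar>f u\<bar> * \<bar>g u - g v\<bar> + \<bar>g v\<bar> * \<bar>f u - f v\<bar>"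
      by (metis abs_mult abs_triangle_ineq)
    also have "\<dots> \<le> \<bar>K\<bar> * (D * \<bar>u - v\<bar>) + \<bar>M\<bar> * (C * \<bar>u - v\<bar>)"
      using lipschitz_onD[OF f uv] lipschitz_onD[OF g uv] K[OF uv(1)] M[OF uv(2)] C
      by (intro add_mono mult_mono) (auto simp: dist_real_def)
    finally show "dist (f u * g u) (f v * g v) \<le> (\<bar>K\<bar> * D + \<bar>M\<bar> * C) * dist u v"
      by (simp add: dist_real_def algebra_simps)
  qed (use C in auto)
  then show ?thesis ..
qed

section \<open>Functions constant along bounces and their rates along
  \<open>X\<^sub>H\<close>\<close>

definition radius2 :: "cotangent \<Rightarrow> real" where
  "radius2 l = (fst l $ 1)\<^sup>2 + (fst l $ 2)\<^sup>2"

definition nu :: "cotangent \<Rightarrow> real" where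
  "nu l = fst l $ 1 * coeff_b l + fst l $ 2 * coeff_c l"

definition tau :: "cotangent \<Rightarrow> real" where
  "tau l = fst l $ 1 * coeff_c l - fst l $ 2 * coeff_b l"

text \<open>Lagrange's identity for the vectors \<open>(x, y)\<close> and \<open>(b, c)\<close>.
  Over the boundary, where the radius is 1, it splits \<open>H\<close> into normal and tangential
  parts.\<close>

lemma nu_tau_power2: "(nu l)\<^sup>2 + (tau l)\<^sup>2 = radius2 l * (H l)\<^sup>2"
  unfolding nu_def tau_def radius2_def H_power2 by algebra

text \<open>The Lipschitz clause makes the fundamental theorem of calculus available along
  characteristics.\<close>

definition bounce_invariant ::
    "(real^3 \<Rightarrow> real) \<Rightarrow> (cotangent \<Rightarrow> real) \<Rightarrow> (cotangent \<Rightarrow> real) \<Rightarrow> bool" where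
  "bounce_invariant G phi Phi \<longleftrightarrow>
     (\<forall>l. \<exists>phi'. (phi has_derivative phi') (at l) \<and>
        (H l = 1 \<longrightarrow> phi' (ham_vf H l) = Phi l) \<and>
        (fst l \<in> frontier Z \<longrightarrow> phi' (ham_vf (G \<circ> fst) l) = 0)) \<and>
     continuous_on UNIV Phi \<and>
     (\<forall>C s t lam. C-lipschitz_on {s..t::real} lam \<longrightarrow> (\<exists>D. D-lipschitz_on {s..t} (phi \<circ> lam)))"

lemma lipschitz_on_fst_nth:
  fixes lam :: "real \<Rightarrow> cotangent"
  assumes "C-lipschitz_on X lam"
  shows "C-lipschitz_on X (\<lambda>u. fst (lam u) $ i)"
proof (rule lipschitz_onI)
  fix u v assume "u \<in> X" "v \<in> X"
  have "dist (fst (lam u) $ i) (fst (lam v) $ i) \<le> dist (fst (lam u)) (fst (lam v))"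
    by (rule dist_vec_nth_le)
  also have "\<dots> \<le> dist (lam u) (lam v)" by (rule dist_fst_le)
  also have "\<dots> \<le> C * dist u v" using assms \<open>u \<in> X\<close> \<open>v \<in> X\<close> by (rule lipschitz_onD)
  finally show "dist (fst (lam u) $ i) (fst (lam v) $ i) \<le> C * dist u v" .
qed (use assms lipschitz_on_nonneg in blast)

lemma lipschitz_on_snd_nth:
  fixes lam :: "real \<Rightarrow> cotangent"
  assumes "C-lipschitz_on X lam"
  shows "C-lipschitz_on X (\<lambda>u. snd (lam u) $ i)"
proof (rule lipschitz_onI)
  fix u v assume "u \<in> X" "v \<in> X"
  have "dist (snd (lam u) $ i) (snd (lam v) $ i) \<le> dist (snd (lam u)) (snd (lam v))"
    by (rule dist_vec_nth_le)
  also have "\<dots> \<le> dist (lam u) (lam v)" by (rule dist_snd_le)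
  also have "\<dots> \<le> C * dist u v" using assms \<open>u \<in> X\<close> \<open>v \<in> X\<close> by (rule lipschitz_onD)
  finally show "dist (snd (lam u) $ i) (snd (lam v) $ i) \<le> C * dist u v" .
qed (use assms lipschitz_on_nonneg in blast)

lemma continuous_on_coeffs [continuous_intros]:
  "continuous_on A coeff_a" "continuous_on A coeff_b" "continuous_on A coeff_c"
  unfolding coeff_a_def[abs_def] coeff_b_def[abs_def] coeff_c_def[abs_def]
  by (auto intro!: continuous_intros)

lemma continuous_on_H [continuous_intros]: "continuous_on A H"
  unfolding H_def[abs_def] by (intro continuous_intros)

lemma ham_vf_H_simps:
  assumes "H l = 1"
  shows "fst (ham_vf H l) $ 1 = coeff_b l" "fst (ham_vf H l) $ 2 = coeff_c l"
    "fst (ham_vf H l) $ 3 = tau l / 2"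
    "snd (ham_vf H l) $ 1 = - coeff_c l * coeff_a l / 2"
    "snd (ham_vf H l) $ 2 = coeff_b l * coeff_a l / 2" "snd (ham_vf H l) $ 3 = 0"
  unfolding ham_vf_H[OF assms] by (simp_all add: tau_def)

context
  fixes G :: "real^3 \<Rightarrow> real"
  assumes G: "table_hamiltonian G"
begin

text \<open>\<open>X\<^sub>G\<close> is vertical, so a bounce does not move the base point; the rate
  \<open>Phi\<close> is the matching component of the velocity of \<open>X\<^sub>H\<close>.\<close>

lemma bounce_invariant_coordinate:
  assumes Phi: "\<And>l. H l = 1 \<Longrightarrow> fst (ham_vf H l) $ i = Phi l" "continuous_on UNIV Phi"
  shows "bounce_invariant G (\<lambda>l. fst l $ i) Phi"
  unfolding bounce_invariant_def
proof (intro conjI allI impI)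
  show "\<exists>phi'. ((\<lambda>l. fst l $ i) has_derivative phi') (at l) \<and>
      (H l = 1 \<longrightarrow> phi' (ham_vf H l) = Phi l) \<and>
      (fst l \<in> frontier Z \<longrightarrow> phi' (ham_vf (G \<circ> fst) l) = 0)" for l
    using Phi(1) by (intro exI[of _ "\<lambda>d. fst d $ i"] conjI has_derivative_fst_nth)
      (auto simp: ham_vf_table_hamiltonian(1)[OF G])
  show "\<exists>D. D-lipschitz_on {s..t} ((\<lambda>l. fst l $ i) \<circ> lam)" if "C-lipschitz_on {s..t} lam"
    for C s t and lam :: "real \<Rightarrow> cotangent"
    using lipschitz_on_fst_nth[OF that] unfolding comp_def by blast
qed (rule Phi(2))

lemma bounce_invariant_x: "bounce_invariant G (\<lambda>l. fst l $ 1) coeff_b"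
  and bounce_invariant_y: "bounce_invariant G (\<lambda>l. fst l $ 2) coeff_c"
  and bounce_invariant_z: "bounce_invariant G (\<lambda>l. fst l $ 3) (\<lambda>l. tau l / 2)"
  by (rule bounce_invariant_coordinate; simp add: ham_vf_H_simps tau_def[abs_def] continuous_intros)+

text \<open>The base velocity in the plane is \<open>(b, c)\<close>, whose product with the gradient
  \<open>2 (x, y)\<close> is twice the normal part.\<close>

lemma bounce_invariant_radius2: "bounce_invariant G radius2 (\<lambda>l. 2 * nu l)"
  unfolding bounce_invariant_def
proof (intro conjI allI impI)
  fix l
  have "(radius2 has_derivative (\<lambda>d. 2 * (fst l $ 1 * fst d $ 1 + fst l $ 2 * fst d $ 2))) (at l)"
    unfolding radius2_def[abs_def] power2_eq_square
    by (auto intro!: derivative_eq_intros has_derivative_fst_nth)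
  then show "\<exists>phi'. (radius2 has_derivative phi') (at l) \<and>
        (H l = 1 \<longrightarrow> phi' (ham_vf H l) = 2 * nu l) \<and>
        (fst l \<in> frontier Z \<longrightarrow> phi' (ham_vf (G \<circ> fst) l) = 0)"
    by (intro exI conjI) (auto simp: ham_vf_H_simps nu_def ham_vf_table_hamiltonian(1)[OF G])
next
  show "continuous_on UNIV (\<lambda>l. 2 * nu l)"
    unfolding nu_def by (intro continuous_intros)
next
  fix C s t and lam :: "real \<Rightarrow> cotangent"
  assume lam: "C-lipschitz_on {s..t} lam"
  note nth = lipschitz_on_fst_nth[OF lam]
  obtain D where D: "D-lipschitz_on {s..t} (\<lambda>u. fst (lam u) $ 1 * fst (lam u) $ 1)"
    using lipschitz_on_mult_Icc[OF nth nth] by blast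
  obtain E where E: "E-lipschitz_on {s..t} (\<lambda>u. fst (lam u) $ 2 * fst (lam u) $ 2)"
    using lipschitz_on_mult_Icc[OF nth nth] by blast
  from lipschitz_on_add[OF D E]
  show "\<exists>D. D-lipschitz_on {s..t} (radius2 \<circ> lam)"
    by (auto simp: radius2_def[abs_def] comp_def power2_eq_square)
qed

text \<open>In canonical coordinates \<open>tau\<close> is the pairing of the covector with the
  rotation field lifted to \<open>xi\<close>: angular momentum plus a multiple of \<open>a\<close>.
  This polynomial form serves for both the derivative and the Lipschitz bound.\<close>

lemma tau_eq:
  "tau l = fst l $ 1 * snd l $ 2 - fst l $ 2 * snd l $ 1 + radius2 l * snd l $ 3 / 2"
  by (simp add: tau_def coeff_b_def coeff_c_def coeff_a_def radius2_def power2_eq_square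
    field_simps)

text \<open>By rotational symmetry \<open>X\<^sub>H\<close> preserves the angular momentum
  \<open>x p2 - y p1\<close>, and it preserves \<open>a\<close>; only \<open>radius2\<close> varies,
  which yields \<open>a nu\<close>. A bounce adds a radial covector, to which \<open>tau\<close> is
  blind.\<close>

lemma bounce_invariant_tau: "bounce_invariant G tau (\<lambda>l. coeff_a l * nu l)"
  unfolding bounce_invariant_def
proof (intro conjI allI impI)
  fix l
  let ?d = "\<lambda>d. fst l $ 1 * snd d $ 2 + fst d $ 1 * snd l $ 2
    - (fst l $ 2 * snd d $ 1 + fst d $ 2 * snd l $ 1)
    + ((fst l $ 1 * fst d $ 1 + fst l $ 2 * fst d $ 2) * snd l $ 3 + radius2 l * snd d $ 3 / 2)"
  have "(tau has_derivative ?d) (at l)"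
    unfolding tau_eq[abs_def] radius2_def power2_eq_square
    by (rule derivative_eq_intros has_derivative_fst_nth has_derivative_snd_nth refl | simp)+
      (auto simp: fun_eq_iff field_simps)
  moreover have "?d (ham_vf H l) = coeff_a l * nu l" if "H l = 1"
    unfolding ham_vf_H_simps[OF that] nu_def coeff_b_def coeff_c_def coeff_a_def
    by (simp add: field_simps)
  moreover have "?d (ham_vf (G \<circ> fst) l) = 0" if "fst l \<in> frontier Z"
    using ham_vf_table_hamiltonian[OF G that] by simp
  ultimately show "\<exists>phi'. (tau has_derivative phi') (at l) \<and>
        (H l = 1 \<longrightarrow> phi' (ham_vf H l) = coeff_a l * nu l) \<and>
        (fst l \<in> frontier Z \<longrightarrow> phi' (ham_vf (G \<circ> fst) l) = 0)"
    by blast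
next
  show "continuous_on UNIV (\<lambda>l. coeff_a l * nu l)"
    unfolding nu_def by (intro continuous_intros)
next
  fix C s t and lam :: "real \<Rightarrow> cotangent"
  assume lam: "C-lipschitz_on {s..t} lam"
  note nth = lipschitz_on_fst_nth[OF lam] lipschitz_on_snd_nth[OF lam]
  obtain D1 where D1: "D1-lipschitz_on {s..t} (\<lambda>u. fst (lam u) $ 1 * snd (lam u) $ 2)"
    using lipschitz_on_mult_Icc[OF nth] by blast
  obtain D2 where D2: "D2-lipschitz_on {s..t} (\<lambda>u. fst (lam u) $ 2 * snd (lam u) $ 1)"
    using lipschitz_on_mult_Icc[OF nth] by blast
  obtain D3 where D3: "D3-lipschitz_on {s..t} (radius2 \<circ> lam)"
    using lam bounce_invariant_radius2 unfolding bounce_invariant_def by blast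
  obtain D4 where "D4-lipschitz_on {s..t} (\<lambda>u. radius2 (lam u) * snd (lam u) $ 3)"
    using lipschitz_on_mult_Icc[OF D3 nth(2)] by auto
  then have "(\<bar>1/2\<bar> * D4)-lipschitz_on {s..t} (\<lambda>u. 1/2 * (radius2 (lam u) * snd (lam u) $ 3))"
    by (rule lipschitz_on_cmult_real)
  from lipschitz_on_add[OF lipschitz_on_diff[OF D1 D2] this]
  show "\<exists>D. D-lipschitz_on {s..t} (tau \<circ> lam)"
    by (auto simp: tau_eq[abs_def] comp_def)
qed

text \<open>Here \<open>h\<close> is the density of the arclength: 1 in the
  \<open>X\<^sub>H\<close>-phases and 0 in the \<open>X\<^sub>G\<close>-phases. One such
  \<open>h\<close> serves all bounce invariants at once, so their increments can be compared with
  that of \<open>sig\<close>.\<close>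

lemma characteristic_speed:
  assumes red: "reduces_to G J lam I gam sig" and st: "{s..t} \<subseteq> J" "s \<le> t"
  obtains h where "(h has_integral sig t - sig s) {s..t}"
    "\<And>u. h u = 0 \<or> h u = 1 \<and> u \<in> {s..t} \<and> H (lam u) = 1"
    "\<And>phi Phi. bounce_invariant G phi Phi \<Longrightarrow>
       ((\<lambda>u. h u * Phi (lam u)) has_integral phi (lam t) - phi (lam s)) {s..t}"
proof -
  obtain C where C: "C-lipschitz_on {s..t} lam"
    using red st lipschitz_on_subset
    unfolding reduces_to_def billiard_characteristic_def by blast
  let ?P = "\<lambda>u. u \<in> J \<longrightarrow>
        lam u \<in> S_over Z \<and> (lam has_vector_derivative ham_vf H (lam u)) (at u within J) \<or>
        lam u \<in> D_over (frontier Z) \<and>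
          (lam has_vector_derivative ham_vf (G \<circ> fst) (lam u)) (at u within J)"
  have "AE u in lebesgue. ?P u"
    using red unfolding reduces_to_def billiard_characteristic_def by blast
  then obtain N where N: "N \<in> null_sets lebesgue" "{u. \<not> ?P u} \<subseteq> N"
    unfolding eventually_ae_filter by auto
  have sig: "sig t - sig s = arclength (fst \<circ> lam) s t"
    using red st unfolding reduces_to_def arclength_reparam_def by (auto simp: subset_iff)
  \<comment> \<open>Good times lie strictly between \<open>s\<close> and \<open>t\<close>, where the
    derivative within \<open>J\<close> is two-sided, and off the null set. The default 0 of
    \<open>h\<close> elsewhere makes the dichotomy of its values hold everywhere.\<close>
  define good where "good u \<longleftrightarrow> s < u \<and> u < t \<and> u \<notin> N" for u
  define h where "h u = (if good u then gnorm (vector_derivative (fst \<circ> lam) (at u)) else 0)" for u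
  have phase: "h u = 1 \<and> H (lam u) = 1 \<and> (lam has_vector_derivative ham_vf H (lam u)) (at u) \<or>
      h u = 0 \<and> fst (lam u) \<in> frontier Z \<and>
        (lam has_vector_derivative ham_vf (G \<circ> fst) (lam u)) (at u)"
    if "good u" for u
  proof -
    have u: "s < u" "u < t" "u \<notin> N" using that by (auto simp: good_def)
    have "{s<..<t} \<subseteq> J" using st by auto
    then have int: "u \<in> interior J"
      using u interior_maximal[of "{s<..<t}" J] by auto
    then have "u \<in> J" using interior_subset by blast
    have h: "h u = gnorm (fst v)" if "(lam has_vector_derivative v) (at u)" for v
    proof -
      have "((fst \<circ> lam) has_vector_derivative fst v) (at u)"
        using that unfolding has_vector_derivative_def comp_def
        by (auto dest: has_derivative_fst)
      then show ?thesis
        using \<open>good u\<close> by (simp add: h_def vector_derivative_at)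
    qed
    have "?P u" using N u by blast
    then consider "H (lam u) = 1" "(lam has_vector_derivative ham_vf H (lam u)) (at u)"
      | "fst (lam u) \<in> frontier Z" "(lam has_vector_derivative ham_vf (G \<circ> fst) (lam u)) (at u)"
      using \<open>u \<in> J\<close> unfolding at_within_interior[OF int] S_over_def D_over_def by auto
    then show ?thesis
    proof cases
      case 1
      then show ?thesis
        using h[OF 1(2)] H_power2[of "lam u"] by (simp add: gnorm_def ham_vf_H_simps)
    next
      case 2
      then show ?thesis
        using h[OF 2(2)] by (simp add: gnorm_def ham_vf_table_hamiltonian(1)[OF G])
    qed
  qed
  have h01: "h u = 0 \<or> h u = 1 \<and> u \<in> {s..t} \<and> H (lam u) = 1" for u
    using phase[of u] by (cases "good u") (auto simp: h_def good_def)
  have inv: "((\<lambda>u. h u * Phi (lam u)) has_integral phi (lam t) - phi (lam s)) {s..t}"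
    if bi: "bounce_invariant G phi Phi" for phi Phi
  proof -
    obtain D where D: "D-lipschitz_on {s..t} (phi \<circ> lam)"
      using bi C unfolding bounce_invariant_def by blast
    have "((phi \<circ> lam) has_real_derivative h u * Phi (lam u)) (at u)"
      if u: "s < u" "u < t" "u \<notin> N" for u
    proof -
      obtain phi' where phi': "(phi has_derivative phi') (at (lam u))"
        "H (lam u) = 1 \<Longrightarrow> phi' (ham_vf H (lam u)) = Phi (lam u)"
        "fst (lam u) \<in> frontier Z \<Longrightarrow> phi' (ham_vf (G \<circ> fst) (lam u)) = 0"
        using bi unfolding bounce_invariant_def by blast
      have chain: "((phi \<circ> lam) has_real_derivative phi' v) (at u)"
        if "(lam has_vector_derivative v) (at u)" for v
        using has_derivative_compose[of lam "\<lambda>r. r *\<^sub>R v" u UNIV phi phi'] that phi'(1)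
          linear_cmul[OF has_derivative_linear[OF phi'(1)]]
        by (simp add: has_vector_derivative_def has_field_derivative_def comp_def
          mult_commute_abs)
      have "good u" using u by (simp add: good_def)
      from phase[OF this] show ?thesis
        using chain phi'(2,3) by (metis mult_1 mult_zero_left)
    qed
    then have "((\<lambda>u. h u * Phi (lam u)) has_integral (phi \<circ> lam) t - (phi \<circ> lam) s) {s..t}"
      using N(1) by (intro lipschitz_fundamental_theorem[OF D st(2)])
        (auto simp: negligible_iff_null_sets)
    then show ?thesis by simp
  qed
  \<comment> \<open>The product \<open>h Phi\<close> is integrable and bounded by 1, hence
    absolutely integrable; it may then be multiplied by the bounded continuous function
    \<open>Phi\<close> along \<open>lam\<close>.\<close>
  have int: "(\<lambda>u. Phi (lam u) * (h u * Phi (lam u))) integrable_on {s..t}"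
    if bi: "bounce_invariant G phi Phi" and le: "\<And>l. \<bar>Phi l\<bar> \<le> H l" for phi Phi
  proof -
    have "(\<lambda>u. h u * Phi (lam u)) absolutely_integrable_on {s..t}"
    proof (rule absolutely_integrable_integrable_bound)
      show "(\<lambda>u. h u * Phi (lam u)) integrable_on {s..t}"
        using inv[OF bi] by blast
      show "(\<lambda>u. 1 :: real) integrable_on {s..t}" by (rule integrable_const_ivl)
      show "norm (h u * Phi (lam u)) \<le> 1" for u
        using h01[of u] le[of "lam u"] by auto
    qed
    moreover have cont: "continuous_on {s..t} (\<lambda>u. Phi (lam u))"
      using bi continuous_on_compose2[OF _ lipschitz_on_continuous_on[OF C]]
      unfolding bounce_invariant_def by blast
    moreover have "bounded ((\<lambda>u. Phi (lam u)) ` {s..t})"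
      by (intro compact_imp_bounded compact_continuous_image cont) auto
    ultimately have "(\<lambda>u. Phi (lam u) * (h u * Phi (lam u))) absolutely_integrable_on {s..t}"
      by (intro absolutely_integrable_bounded_measurable_product_real[where f="\<lambda>u. Phi (lam u)"]
        continuous_imp_measurable_on_sets_lebesgue) auto
    then show ?thesis by (rule set_lebesgue_integral_eq_integral(1))
  qed
  \<comment> \<open>Nothing is known a priori about the measurability of the set of
    \<open>X\<^sub>H\<close>-phases. Integrability comes from \<open>h = b (h b) + c (h c)\<close>,
    valid because \<open>b\<^sup>2 + c\<^sup>2 = 1\<close> where \<open>h\<close> is not 0, with
    \<open>h b\<close> and \<open>h c\<close> governed by the coordinates \<open>x\<close> and
    \<open>y\<close>.\<close>
  have "h integrable_on {s..t}"
  proof -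
    have "(\<lambda>u. coeff_b (lam u) * (h u * coeff_b (lam u)) + coeff_c (lam u) * (h u * coeff_c (lam u)))
        integrable_on {s..t}"
      by (intro integrable_add int[OF bounce_invariant_x] int[OF bounce_invariant_y])
        (simp_all add: H_def real_le_rsqrt)
    moreover have "coeff_b (lam u) * (h u * coeff_b (lam u)) + coeff_c (lam u) * (h u * coeff_c (lam u))
        = h u" for u
      using h01[of u] H_power2[of "lam u"] by (auto simp: power2_eq_square)
    ultimately show ?thesis by simp
  qed
  moreover have "integral {s..t} h = sig t - sig s"
    unfolding sig arclength_def
    by (rule integral_spike[of "N \<union> {s, t}"])
      (use N in \<open>auto simp: h_def good_def negligible_iff_null_sets[symmetric]\<close>)
  ultimately have "(h has_integral sig t - sig s) {s..t}"
    by (metis integrable_integral)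
  then show thesis using h01 inv by (rule that)
qed

lemma time_change_increment:
  assumes "reduces_to G J lam I gam sig" "{s..t} \<subseteq> J" "s \<le> t"
  shows "\<bar>sig t - sig s\<bar> \<le> t - s"
proof -
  obtain h where h: "(h has_integral sig t - sig s) {s..t}"
    "\<And>u. h u = 0 \<or> h u = 1 \<and> u \<in> {s..t} \<and> H (lam u) = 1"
    using characteristic_speed[OF assms] by metis
  have "norm (sig t - sig s) \<le> 1 * measure lborel {s..t}"
  proof (rule has_integral_bound_real[OF _ finite.emptyI h(1)])
    show "norm (h u) \<le> 1" for u
      using h(2)[of u] by (elim disjE) simp_all
  qed simp
  then show ?thesis using assms by simp
qed

text \<open>An \<open>X\<^sub>H\<close>-phase requires \<open>H = 1\<close>, so the density
  \<open>h\<close> vanishes on the whole interval.\<close>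

lemma time_change_constant:
  assumes "reduces_to G J lam I gam sig" "{s..t} \<subseteq> J" "s \<le> t"
    and "\<And>u. u \<in> {s..t} \<Longrightarrow> H (lam u) < 1"
  shows "sig t = sig s"
proof -
  obtain h where h: "(h has_integral sig t - sig s) {s..t}"
    "\<And>u. h u = 0 \<or> h u = 1 \<and> u \<in> {s..t} \<and> H (lam u) = 1"
    using characteristic_speed[OF assms(1-3)] by metis
  have "h u = 0" for u using h(2)[of u] assms(4)[of u] by auto
  then have "(h has_integral 0) {s..t}" by (simp add: has_integral_is_0)
  from has_integral_unique[OF h(1) this] show ?thesis by simp
qed

text \<open>The increment is the integral of \<open>h (Phi - F)\<close>, and
  \<open>0 \<le> h \<le> 1\<close>. Freezing the rate at a constant \<open>F\<close> expresses the
  relation between \<open>phi\<close> and \<open>sig\<close> by values alone, a form that survives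
  pointwise limits.\<close>

lemma bounce_invariant_increment:
  assumes "reduces_to G J lam I gam sig" "{s..t} \<subseteq> J" "s \<le> t"
    and phi: "bounce_invariant G phi Phi"
    and F: "\<And>u. u \<in> {s..t} \<Longrightarrow> \<bar>Phi (lam u) - F\<bar> \<le> e"
  shows "\<bar>phi (lam t) - phi (lam s) - F * (sig t - sig s)\<bar> \<le> e * (t - s)"
proof -
  obtain h where h: "(h has_integral sig t - sig s) {s..t}"
    "\<And>u. h u = 0 \<or> h u = 1 \<and> u \<in> {s..t} \<and> H (lam u) = 1"
    "((\<lambda>u. h u * Phi (lam u)) has_integral phi (lam t) - phi (lam s)) {s..t}"
    using characteristic_speed[OF assms(1-3)] phi by metis
  have e: "0 \<le> e" using F[of s] assms(3) by auto
  have int: "((\<lambda>u. h u * Phi (lam u) - F * h u) has_integral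
      phi (lam t) - phi (lam s) - F * (sig t - sig s)) {s..t}"
    by (intro has_integral_diff has_integral_mult_right h)
  have "norm (phi (lam t) - phi (lam s) - F * (sig t - sig s)) \<le> e * measure lborel {s..t}"
  proof (rule has_integral_bound_real[OF e finite.emptyI int])
    fix u assume u: "u \<in> {s..t} - {}"
    from h(2)[of u] show "norm (h u * Phi (lam u) - F * h u) \<le> e"
    proof
      assume "h u = 0"
      then show ?thesis using e by simp
    next
      assume "h u = 1 \<and> u \<in> {s..t} \<and> H (lam u) = 1"
      then show ?thesis using F[of u] by simp
    qed
  qed
  then show ?thesis using assms(3) by simp
qed

lemma H_le_1:
  assumes "reduces_to G J lam I gam sig" "t \<in> J"
  shows "H (lam t) \<le> 1"
  using assms
  by (auto simp: reduces_to_def billiard_characteristic_def B_def S_over_def D_over_def image_subset_iff)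

end

section \<open>Passage to the limit\<close>

lemma C0_loc_converges_pointwise:
  assumes "C0_loc_converges Jn fn J f" "t \<in> interior J"
  shows "(\<lambda>n. fn n t) \<longlonglongrightarrow> f t"
proof -
  have "compact {t}" "{t} \<subseteq> interior J" using assms by auto
  then have "uniform_limit {t} fn f sequentially"
    using assms unfolding C0_loc_converges_def by blast
  then show ?thesis by (rule tendsto_uniform_limitI) simp
qed

text \<open>Near \<open>s\<close> the limit curve stays well inside \<open>U\<close>, so by uniform
  convergence all late approximants stay in \<open>U\<close> on one common interval. The estimate
  holds for them there and passes to the limit.\<close>

lemma limit_increment:
  assumes lam: "C0_loc_converges Jn lamn J (lam :: real \<Rightarrow> 'a::metric_space)"
    and s: "s \<in> interior J"
    and U: "open U" "lam s \<in> U"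
    and f: "\<And>t. t \<in> interior J \<Longrightarrow> (\<lambda>n. fn n t) \<longlonglongrightarrow> (f t :: real)"
    and le: "\<And>n a b. {a..b} \<subseteq> Jn n \<Longrightarrow> a \<le> b \<Longrightarrow> lamn n ` {a..b} \<subseteq> U \<Longrightarrow>
      \<bar>fn n b - fn n a\<bar> \<le> e * (b - a)"
  shows "\<exists>d>0. \<forall>t. \<bar>t - s\<bar> < d \<longrightarrow> \<bar>f t - f s\<bar> \<le> e * \<bar>t - s\<bar>"
proof -
  obtain r where r: "r > 0" "ball (lam s) r \<subseteq> U"
    using U openE by blast
  have "continuous_on (interior J) lam"
    using lam by (auto simp: C0_loc_converges_def intro: continuous_on_subset[OF _ interior_subset])
  then have "isCont lam s"
    using s by (simp add: continuous_on_eq_continuous_at)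
  \<comment> \<open>Half of \<open>r\<close> pays for the continuity of \<open>lam\<close>, the
    other half for the uniform convergence.\<close>
  then obtain d1 where d1: "d1 > 0" "\<And>t. dist t s < d1 \<Longrightarrow> dist (lam t) (lam s) < r/2"
    using half_gt_zero[OF r(1)] unfolding continuous_at_eps_delta by blast
  obtain d2 where d2: "d2 > 0" "cball s d2 \<subseteq> interior J"
    using s open_contains_cball[of "interior J"] by auto
  define d where "d = min (d1/2) d2"
  have d: "d > 0" using d1(1) d2(1) by (simp add: d_def)
  have K: "cball s d \<subseteq> interior J" using d2 by (auto simp: d_def)
  have ev: "\<forall>\<^sub>F n in sequentially. cball s d \<subseteq> Jn n \<and> (\<forall>u\<in>cball s d. lamn n u \<in> U)"
  proof -
    have unif: "uniform_limit (cball s d) lamn lam sequentially"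
      using lam K unfolding C0_loc_converges_def by auto
    have "\<forall>\<^sub>F n in sequentially. cball s d \<subseteq> Jn n"
      using lam K unfolding C0_loc_converges_def by auto
    then show ?thesis using uniform_limitD[OF unif half_gt_zero[OF r(1)]]
    proof eventually_elim
      case (elim n)
      have "lamn n u \<in> U" if "u \<in> cball s d" for u
      proof -
        have "dist (lam u) (lam s) < r/2"
          using that d1 by (intro d1) (auto simp: d_def dist_commute)
        then have "dist (lamn n u) (lam s) < r"
          using elim(2) that dist_triangle_half_r[of "lam u" "lamn n u" r "lam s"]
          by (auto simp: dist_commute)
        then show ?thesis using r by (auto simp: dist_commute)
      qed
      then show ?case using elim by blast
    qed
  qed
  have "\<bar>f t - f s\<bar> \<le> e * \<bar>t - s\<bar>" if t: "\<bar>t - s\<bar> < d" for t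
  proof (rule tendsto_upperbound)
    have ts: "t \<in> cball s d" "s \<in> cball s d" using t d by (auto simp: dist_real_def)
    show "(\<lambda>n. \<bar>fn n t - fn n s\<bar>) \<longlonglongrightarrow> \<bar>f t - f s\<bar>"
      by (intro tendsto_intros f) (use ts K in auto)
    show "\<forall>\<^sub>F n in sequentially. \<bar>fn n t - fn n s\<bar> \<le> e * \<bar>t - s\<bar>"
      using ev
    proof eventually_elim
      case (elim n)
      have "{min s t..max s t} \<subseteq> cball s d" using t by (auto simp: dist_real_def)
      then have "\<bar>fn n (max s t) - fn n (min s t)\<bar> \<le> e * (max s t - min s t)"
        using elim by (intro le) (auto simp: image_subset_iff subset_iff)
      then show ?case by (auto simp: max_def min_def abs_minus_commute split: if_splits)
    qed
  qed simp
  then show ?thesis using d by blast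
qed

lemma limit_bounce_invariant:
  assumes G: "table_hamiltonian G"
    and red: "\<And>n. reduces_to G (Jn n) (lamn n) (In n) (gamn n) (sigs n)"
    and lam: "C0_loc_converges Jn lamn J lam" and sig: "C0_loc_converges Jn sigs J sig"
    and s: "s \<in> interior J"
    and phi: "bounce_invariant G phi Phi"
  shows "((\<lambda>t. phi (lam t) - Phi (lam s) * sig t) has_real_derivative 0) (at s)"
proof -
  note pw = C0_loc_converges_pointwise[OF lam] C0_loc_converges_pointwise[OF sig]
  have phi_cont: "isCont phi l" for l
    using phi has_derivative_continuous unfolding bounce_invariant_def by blast
  have "\<exists>d>0. \<forall>t. \<bar>t - s\<bar> < d \<longrightarrow>
      \<bar>(phi (lam t) - Phi (lam s) * sig t) - (phi (lam s) - Phi (lam s) * sig s)\<bar> \<le> e * \<bar>t - s\<bar>"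
    if e: "e > 0" for e
  proof (rule limit_increment[OF lam s])
    let ?U = "{l. \<bar>Phi l - Phi (lam s)\<bar> < e}"
    show "open ?U"
      using phi unfolding bounce_invariant_def by (intro open_Collect_less continuous_intros) auto
    show "lam s \<in> ?U" using e by simp
    show "(\<lambda>n. phi (lamn n t) - Phi (lam s) * sigs n t) \<longlonglongrightarrow> phi (lam t) - Phi (lam s) * sig t"
      if "t \<in> interior J" for t
      by (intro tendsto_intros pw that isCont_tendsto_compose[OF phi_cont])
    show "\<bar>(phi (lamn n b) - Phi (lam s) * sigs n b) - (phi (lamn n a) - Phi (lam s) * sigs n a)\<bar>
        \<le> e * (b - a)"
      if "{a..b} \<subseteq> Jn n" "a \<le> b" "lamn n ` {a..b} \<subseteq> ?U" for n a b
    proof -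
      have "\<bar>phi (lamn n b) - phi (lamn n a) - Phi (lam s) * (sigs n b - sigs n a)\<bar> \<le> e * (b - a)"
        using that(3)
        by (intro bounce_invariant_increment[OF G red that(1,2) phi]) (auto simp: image_subset_iff less_imp_le)
      then show ?thesis by (simp add: algebra_simps)
    qed
  qed
  then show ?thesis
    unfolding has_field_derivative_def has_derivative_at_alt
    by (auto simp: bounded_linear_mult_right)
qed

text \<open>The bound 1 on the arclength rate and the inequality \<open>H \<le> 1\<close> pass to
  the limit directly. Where \<open>H < 1\<close> at the limit, late approximants are in
  \<open>X\<^sub>G\<close>-phases throughout a common neighbourhood of \<open>s\<close>.\<close>

lemma limit_time_change:
  assumes G: "table_hamiltonian G"
    and red: "\<And>n. reduces_to G (Jn n) (lamn n) (In n) (gamn n) (sigs n)"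
    and lam: "C0_loc_converges Jn lamn J lam" and sig: "C0_loc_converges Jn sigs J sig"
    and s: "s \<in> interior J"
  shows "\<exists>d>0. \<forall>t. \<bar>t - s\<bar> < d \<longrightarrow> \<bar>sig t - sig s\<bar> \<le> \<bar>t - s\<bar>"
    and "H (lam s) \<le> 1"
    and "H (lam s) < 1 \<Longrightarrow> (sig has_real_derivative 0) (at s)"
proof -
  note pw = C0_loc_converges_pointwise[OF lam] C0_loc_converges_pointwise[OF sig]
  have "\<exists>d>0. \<forall>t. \<bar>t - s\<bar> < d \<longrightarrow> \<bar>sig t - sig s\<bar> \<le> 1 * \<bar>t - s\<bar>"
  proof (rule limit_increment[OF lam s open_UNIV UNIV_I pw(2)])
    show "\<bar>sigs n b - sigs n a\<bar> \<le> 1 * (b - a)" if "{a..b} \<subseteq> Jn n" "a \<le> b" for n a b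
      using time_change_increment[OF G red that] by simp
  qed
  then show "\<exists>d>0. \<forall>t. \<bar>t - s\<bar> < d \<longrightarrow> \<bar>sig t - sig s\<bar> \<le> \<bar>t - s\<bar>" by simp
  have H_cont: "isCont H l" for l
    using continuous_on_H[of UNIV] unfolding continuous_on_eq_continuous_at[OF open_UNIV] by blast
  show "H (lam s) \<le> 1"
  proof (rule tendsto_upperbound)
    show "(\<lambda>n. H (lamn n s)) \<longlonglongrightarrow> H (lam s)"
      by (intro isCont_tendsto_compose[OF H_cont] pw s)
    have "\<forall>\<^sub>F n in sequentially. {s} \<subseteq> Jn n"
      using lam s unfolding C0_loc_converges_def by (metis compact_sing empty_subsetI insert_subset)
    then show "\<forall>\<^sub>F n in sequentially. H (lamn n s) \<le> 1"
      by eventually_elim (use H_le_1[OF G red] in auto)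
  qed simp
  show "(sig has_real_derivative 0) (at s)" if "H (lam s) < 1"
  proof -
    \<comment> \<open>The rate 0 expresses that \<open>sig\<close> is constant near
      \<open>s\<close>.\<close>
    have "\<exists>d>0. \<forall>t. \<bar>t - s\<bar> < d \<longrightarrow> \<bar>sig t - sig s\<bar> \<le> 0 * \<bar>t - s\<bar>"
    proof (rule limit_increment[OF lam s _ _ pw(2)])
      show "open {l. H l < 1}" by (intro open_Collect_less continuous_intros)
      show "\<bar>sigs n b - sigs n a\<bar> \<le> 0 * (b - a)"
        if "{a..b} \<subseteq> Jn n" "a \<le> b" "lamn n ` {a..b} \<subseteq> {l. H l < 1}" for n a b
        using time_change_constant[OF G red that(1,2)] that(3) by (auto simp: image_subset_iff)
    qed (use that in auto)
    then obtain d where d: "d > 0" "\<And>t. \<bar>t - s\<bar> < d \<Longrightarrow> sig t = sig s" by auto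
    have "((\<lambda>t. sig s) has_real_derivative 0) (at s)" by simp
    then show ?thesis
    proof (rule has_field_derivative_transform_within[OF _ d(1)])
      show "sig s = sig t" if "dist t s < d" for t
        using d(2)[of t] that by (simp add: dist_real_def)
    qed simp
  qed
qed

section \<open>Calculus relative to a Lipschitz time change\<close>

lemma DERIV_zero_compose_lipschitz:
  fixes m sig :: "real \<Rightarrow> real"
  assumes lip: "\<exists>d>0. \<forall>t. \<bar>t - s\<bar> < d \<longrightarrow> \<bar>sig t - sig s\<bar> \<le> \<bar>t - s\<bar>"
    and m: "(m has_real_derivative 0) (at (sig s))"
  shows "((\<lambda>t. m (sig t)) has_real_derivative 0) (at s)"
proof -
  have "\<exists>d>0. \<forall>t. \<bar>t - s\<bar> < d \<longrightarrow> \<bar>m (sig t) - m (sig s)\<bar> \<le> e * \<bar>t - s\<bar>" if e: "e > 0" for e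
  proof -
    obtain d1 where d1: "d1 > 0" "\<And>t. \<bar>t - s\<bar> < d1 \<Longrightarrow> \<bar>sig t - sig s\<bar> \<le> \<bar>t - s\<bar>"
      using lip by blast
    obtain d2 where d2: "d2 > 0"
      "\<And>S. \<bar>S - sig s\<bar> < d2 \<Longrightarrow> \<bar>m S - m (sig s)\<bar> \<le> e * \<bar>S - sig s\<bar>"
      using m e unfolding has_field_derivative_def has_derivative_at_alt by auto
    \<comment> \<open>An error that is small relative to the increment of \<open>sig\<close> is
      small relative to that of \<open>t\<close>, so no derivative of \<open>sig\<close>
      enters.\<close>
    have "\<bar>m (sig t) - m (sig s)\<bar> \<le> e * \<bar>t - s\<bar>" if t: "\<bar>t - s\<bar> < min d1 d2" for t
    proof -
      have le: "\<bar>sig t - sig s\<bar> \<le> \<bar>t - s\<bar>" using d1 t by simp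
      then have "\<bar>m (sig t) - m (sig s)\<bar> \<le> e * \<bar>sig t - sig s\<bar>" using d2 t by simp
      also have "\<dots> \<le> e * \<bar>t - s\<bar>" using le e by simp
      finally show ?thesis .
    qed
    then show ?thesis using d1(1) d2(1) by (intro exI[of _ "min d1 d2"]) simp
  qed
  then show ?thesis
    unfolding has_field_derivative_def has_derivative_at_alt
    by (auto simp: bounded_linear_mult_right)
qed

text \<open>The difference quotient is that of \<open>u\<close> multiplied by \<open>v t\<close>,
  hence tends to 0 times \<open>v s\<close>. This covers factors that are merely continuous.\<close>

lemma DERIV_zero_mult_isCont:
  fixes u v :: "real \<Rightarrow> real"
  assumes u: "(u has_real_derivative 0) (at s)" and v: "isCont v s"
  shows "((\<lambda>t. (u t - u s) * v t) has_real_derivative 0) (at s)"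
proof -
  have "((\<lambda>t. (u t - u s) / (t - s) * v t) \<longlongrightarrow> 0 * v s) (at s)"
    using u v unfolding has_field_derivative_iff isCont_def by (intro tendsto_mult)
  then show ?thesis by (simp add: has_field_derivative_iff)
qed

text \<open>A product rule for functions with a derivative relative to a Lipschitz, possibly
  nondifferentiable, time change.\<close>

lemma DERIV_zero_time_change_mult:
  fixes x psi sig :: "real \<Rightarrow> real"
  assumes lip: "\<exists>d>0. \<forall>t. \<bar>t - s\<bar> < d \<longrightarrow> \<bar>sig t - sig s\<bar> \<le> \<bar>t - s\<bar>"
    and cont: "isCont sig s"
    and x: "((\<lambda>t. x t - F * sig t) has_real_derivative 0) (at s)"
    and psi: "(psi has_real_derivative D) (at (sig s))"
  shows "((\<lambda>t. x t * psi (sig t) - (F * psi (sig s) + x s * D) * sig t) has_real_derivative 0) (at s)"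
proof -
  define X where "X t = x t - F * sig t" for t
  \<comment> \<open>With \<open>x\<close> split as \<open>X + F sig\<close>, the function in
    question is the sum of \<open>(X t - X s) psi (sig t)\<close> and \<open>m (sig t)\<close>. The
    coefficient of the linear term is chosen so that \<open>m\<close> has derivative 0 at
    \<open>sig s\<close>.\<close>
  define m where "m S = (F * S + X s) * psi S - (F * psi (sig s) + x s * D) * S" for S
  have "(m has_real_derivative 0) (at (sig s))"
    unfolding m_def by (rule derivative_eq_intros psi refl)+ (simp add: X_def algebra_simps)
  then have m: "((\<lambda>t. m (sig t)) has_real_derivative 0) (at s)"
    by (rule DERIV_zero_compose_lipschitz[OF lip])
  have "isCont (\<lambda>t. psi (sig t)) s"
    using isCont_o2[OF cont DERIV_isCont[OF psi]] .
  then have "((\<lambda>t. (X t - X s) * psi (sig t)) has_real_derivative 0) (at s)"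
    using x unfolding X_def by (intro DERIV_zero_mult_isCont)
  from DERIV_add[OF this m] show ?thesis
    by (simp add: m_def X_def algebra_simps)
qed

text \<open>The mean value theorem on the open interval between two points; continuity on
  \<open>J\<close> takes care of endpoints that belong to \<open>J\<close>.\<close>

lemma constant_on_curve_domain:
  fixes f :: "real \<Rightarrow> real"
  assumes J: "curve_domain J" and cont: "continuous_on J f"
    and deriv: "\<And>t. t \<in> interior J \<Longrightarrow> (f has_real_derivative 0) (at t)"
    and st: "s \<in> J" "t \<in> J"
  shows "f s = f t"
proof -
  have "f b = f a" if ab: "a \<in> J" "b \<in> J" "a < b" for a b
  proof (rule DERIV_isconst_end[OF \<open>a < b\<close>])
    have sub: "{a..b} \<subseteq> J"
      using J ab unfolding curve_domain_def is_interval_1 by (meson atLeastAtMost_iff subsetI)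
    show "continuous_on {a..b} f" by (rule continuous_on_subset[OF cont sub])
    have "{a<..<b} \<subseteq> J" using sub greaterThanLessThan_subseteq_atLeastAtMost_iff by blast
    then have "{a<..<b} \<subseteq> interior J" by (rule interior_maximal) simp
    then show "(f has_real_derivative 0) (at x)" if "a < x" "x < b" for x
      using that by (intro deriv) auto
  qed
  then show ?thesis using st by (metis linorder_less_linear)
qed

lemma curve_domain_not_singleton: "curve_domain I \<Longrightarrow> I \<noteq> {a}"
  by (auto simp: curve_domain_def)

section \<open>Helices of slope 1 on the boundary cylinder\<close>

definition helix_point :: "real \<Rightarrow> real \<Rightarrow> real^3" where
  "helix_point z0 th = vector [cos th, sin th, z0 + th / 2]"

lemma helix_point_nth [simp]:
  "helix_point z0 th $ 1 = cos th" "helix_point z0 th $ 2 = sin th"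
  "helix_point z0 th $ 3 = z0 + th / 2"
  by (simp_all add: helix_point_def)

lemma helix_1: "helix 1 z0 = range (helix_point z0)"
  by (simp add: helix_def helix_point_def[abs_def])

lemma eq_helix_point_iff:
  "q = helix_point z0 th \<longleftrightarrow> q $ 1 = cos th \<and> q $ 2 = sin th \<and> q $ 3 = z0 + th / 2"
  by (simp add: vec_eq_iff forall_3)

lemma helix_point_frontier: "helix_point z0 th \<in> frontier Z"
  by (simp add: frontier_Z)

lemma frontier_helix_point:
  assumes "q \<in> frontier Z"
  obtains th z0 where "q = helix_point z0 th"
proof -
  obtain th where "q $ 1 = cos th" "q $ 2 = sin th"
    using assms sincos_total_2pi[of "q $ 1" "q $ 2"] unfolding frontier_Z by blast
  then have "q = helix_point (q $ 3 - th / 2) th"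
    by (simp add: eq_helix_point_iff)
  then show thesis by (rule that)
qed

text \<open>The equality case of Cauchy-Schwarz. A point on the circle is thus identified with a
  moving model point by showing that one scalar, their inner product, is constantly 1.\<close>

lemma unit_vector_eq_cos_sin:
  fixes x y th :: real
  assumes "x\<^sup>2 + y\<^sup>2 = 1" "x * cos th + y * sin th = 1"
  shows "x = cos th" "y = sin th"
proof -
  have "(x - cos th)\<^sup>2 + (y - sin th)\<^sup>2
      = (x\<^sup>2 + y\<^sup>2) + ((cos th)\<^sup>2 + (sin th)\<^sup>2) - 2 * (x * cos th + y * sin th)"
    by (simp add: power2_eq_square algebra_simps)
  then have "(x - cos th)\<^sup>2 + (y - sin th)\<^sup>2 = 0"
    unfolding assms by simp
  then show "x = cos th" "y = sin th"
    by (simp_all add: sum_power2_eq_zero_iff)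
qed

text \<open>The laws for \<open>radius2\<close> and \<open>tau\<close> fix the covector up to
  \<open>a\<close>, and those for the coordinates then fix the curve. The sign \<open>e\<close> is
  the constant value of \<open>tau\<close>, hence the direction of travel.\<close>

lemma limit_on_boundary_helix:
  assumes G: "table_hamiltonian G"
    and red: "\<And>n. reduces_to G (Jn n) (lamn n) (In n) (gamn n) (sigs n)"
    and lam: "C0_loc_converges Jn lamn J lam" and sig: "C0_loc_converges Jn sigs J sig"
    and dom: "curve_domain J" "curve_domain I" and onto: "sig ` J = I"
    and proj: "\<And>t. t \<in> J \<Longrightarrow> fst (lam t) = gam (sig t)"
    and bdry: "gam ` I \<subseteq> frontier Z"
  obtains e th0 z0 where "e\<^sup>2 = 1" "\<And>s. s \<in> I \<Longrightarrow> gam s = helix_point z0 (th0 + e * s)"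
proof -
  note red_lim = limit_bounce_invariant[OF G red lam sig]
    and time = limit_time_change[OF G red lam sig]
  have cont: "continuous_on J lam" "continuous_on J sig"
    using lam sig by (auto simp: C0_loc_converges_def)
  have R: "(fst (lam t) $ 1)\<^sup>2 + (fst (lam t) $ 2)\<^sup>2 = 1" if "t \<in> J" for t
    using bdry onto proj[OF that] that by (auto simp: frontier_Z)
  have HR: "(nu (lam t))\<^sup>2 + (tau (lam t))\<^sup>2 = (H (lam t))\<^sup>2" if "t \<in> J" for t
    using nu_tau_power2[of "lam t"] R[OF that] by (simp add: radius2_def)
  have int: "t \<in> J" if "t \<in> interior J" for t using that interior_subset by blast
  \<comment> \<open>Over the boundary \<open>radius2\<close> is constantly 1, so its law leaves only
    the term with \<open>sig\<close>.\<close>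
  have nu_sig: "((\<lambda>t. nu (lam s) * sig t) has_real_derivative 0) (at s)" if s: "s \<in> interior J" for s
  proof -
    have "((\<lambda>t. 1 - 2 * nu (lam s) * sig t) has_real_derivative 0) (at s)"
      by (rule has_field_derivative_transform_within_open[OF red_lim[OF s bounce_invariant_radius2[OF G]]
            open_interior s]) (use R int in \<open>auto simp: radius2_def\<close>)
    from DERIV_cdivide[OF DERIV_diff[OF DERIV_const[of 1] this], of 2]
    show ?thesis by simp
  qed
  have tau_const: "tau (lam s) = tau (lam t)" if "s \<in> J" "t \<in> J" for s t
  proof (rule constant_on_curve_domain[OF dom(1) _ _ that])
    show "continuous_on J (\<lambda>t. tau (lam t))"
    proof (rule continuous_on_compose2[OF _ cont(1)])
      show "continuous_on UNIV tau"
        unfolding tau_def[abs_def] by (intro continuous_intros)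
    qed simp
    show "((\<lambda>t. tau (lam t)) has_real_derivative 0) (at s)" if s: "s \<in> interior J" for s
      using DERIV_add[OF red_lim[OF s bounce_invariant_tau[OF G]]
        DERIV_cmult[OF nu_sig[OF s], of "coeff_a (lam s)"]]
      by (simp add: mult.assoc)
  qed
  obtain t0 where t0: "t0 \<in> interior J" using dom by (auto simp: curve_domain_def)
  define e where "e = tau (lam t0)"
  have tau: "tau (lam t) = e" if "t \<in> J" for t
    using tau_const[OF that int[OF t0]] by (simp add: e_def)
  have nu_e: "(nu (lam t))\<^sup>2 + e\<^sup>2 = (H (lam t))\<^sup>2" if "t \<in> J" for t
    using HR[OF that] tau[OF that] by simp
  have H1: "0 \<le> H l" for l by (simp add: H_def)
  have e_le: "(nu (lam t))\<^sup>2 + e\<^sup>2 \<le> 1" if t: "t \<in> interior J" for t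
    unfolding nu_e[OF int[OF t]] using time(2)[OF t] H1 by (simp add: power_le_one)
  have e1: "e\<^sup>2 = 1"
  proof (rule ccontr)
    assume "e\<^sup>2 \<noteq> 1"
    then have lt: "e\<^sup>2 < 1" using e_le[OF t0] by (smt (verit) zero_le_power2)
    have "(sig has_real_derivative 0) (at s)" if s: "s \<in> interior J" for s
    proof (cases "H (lam s) < 1")
      case True
      then show ?thesis using time(3)[OF s] by blast
    next
      case False
      then have "H (lam s) = 1" using time(2)[OF s] by simp
      then have "nu (lam s) \<noteq> 0" using nu_e[OF int[OF s]] lt by auto
      then show ?thesis using DERIV_cmult[OF nu_sig[OF s], of "1 / nu (lam s)"] by simp
    qed
    \<comment> \<open>A constant \<open>sig\<close> would collapse \<open>I\<close> to a point,
      although a curve domain has nonempty interior.\<close>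
    then have "sig t \<in> {sig t0}" if "t \<in> J" for t
      using constant_on_curve_domain[OF dom(1) cont(2)] that int[OF t0] by blast
    then have "I \<subseteq> {sig t0}" using onto by blast
    moreover have "sig t0 \<in> I" using onto int[OF t0] by blast
    ultimately show False using curve_domain_not_singleton[OF dom(2)] by blast
  qed
  have nu0: "nu (lam t) = 0" if "t \<in> interior J" for t
    using e_le[OF that] e1 by simp
  have bc: "coeff_b (lam t) = - e * fst (lam t) $ 2" "coeff_c (lam t) = e * fst (lam t) $ 1"
    if t: "t \<in> interior J" for t
    using nu0[OF t] tau[OF int[OF t]] R[OF int[OF t]] unfolding nu_def tau_def by algebra+
  have sig_cont: "isCont sig s" if "s \<in> interior J" for s
    using continuous_on_interior[OF cont(2) that] .
  obtain th z0 where q0: "fst (lam t0) = helix_point z0 th"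
  proof (rule frontier_helix_point)
    show "fst (lam t0) \<in> frontier Z"
      using bdry onto proj[OF int[OF t0]] int[OF t0] by auto
  qed
  \<comment> \<open>The phase is chosen so that the model angle at time \<open>t0\<close> is
    \<open>th\<close>.\<close>
  define th0 where "th0 = th - e * sig t0"
  let ?th = "\<lambda>S. th0 + e * S"
  have z: "fst (lam t) $ 3 = z0 + ?th (sig t) / 2" if "t \<in> J" for t
  proof -
    have "fst (lam t) $ 3 - e / 2 * sig t = fst (lam t0) $ 3 - e / 2 * sig t0"
    proof (rule constant_on_curve_domain[OF dom(1) _ _ that int[OF t0]])
      show "continuous_on J (\<lambda>t. fst (lam t) $ 3 - e / 2 * sig t)"
        by (intro continuous_intros cont)
      show "((\<lambda>t. fst (lam t) $ 3 - e / 2 * sig t) has_real_derivative 0) (at s)"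
        if s: "s \<in> interior J" for s
        using red_lim[OF s bounce_invariant_z[OF G]] tau[OF int[OF s]] by simp
    qed
    then show ?thesis by (simp add: q0 th0_def field_simps)
  qed
  \<comment> \<open>The inner product of the curve with the model point of angle
    \<open>th0 + e sig\<close>, both projected to the plane. By \<open>bc\<close> both turn at rate
    \<open>e\<close> relative to \<open>sig\<close>, so it keeps its initial value 1.\<close>
  have w: "fst (lam t) $ 1 * cos (?th (sig t)) + fst (lam t) $ 2 * sin (?th (sig t)) = 1"
    if "t \<in> J" for t
  proof -
    have "fst (lam t) $ 1 * cos (?th (sig t)) + fst (lam t) $ 2 * sin (?th (sig t))
        = fst (lam t0) $ 1 * cos (?th (sig t0)) + fst (lam t0) $ 2 * sin (?th (sig t0))"
    proof (rule constant_on_curve_domain[OF dom(1) _ _ that int[OF t0]])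
      show "continuous_on J (\<lambda>t. fst (lam t) $ 1 * cos (?th (sig t)) + fst (lam t) $ 2 * sin (?th (sig t)))"
        by (intro continuous_intros cont)
      fix s assume s: "s \<in> interior J"
      have "((\<lambda>S. cos (?th S)) has_real_derivative - e * sin (?th (sig s))) (at (sig s))"
        by (auto intro!: derivative_eq_intros)
      note 1 = DERIV_zero_time_change_mult[OF time(1)[OF s] sig_cont[OF s]
          red_lim[OF s bounce_invariant_x[OF G]] this]
      have "((\<lambda>S. sin (?th S)) has_real_derivative e * cos (?th (sig s))) (at (sig s))"
        by (auto intro!: derivative_eq_intros)
      note 2 = DERIV_zero_time_change_mult[OF time(1)[OF s] sig_cont[OF s]
          red_lim[OF s bounce_invariant_y[OF G]] this]
      from DERIV_add[OF 1 2]
      show "((\<lambda>t. fst (lam t) $ 1 * cos (?th (sig t)) + fst (lam t) $ 2 * sin (?th (sig t)))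
          has_real_derivative 0) (at s)"
        by (simp add: bc[OF s] algebra_simps)
    qed
    also have "\<dots> = 1"
      by (simp add: q0 th0_def flip: power2_eq_square)
    finally show ?thesis .
  qed
  show thesis
  proof (rule that[OF e1])
    fix s assume "s \<in> I"
    then obtain t where t: "t \<in> J" "s = sig t" using onto by blast
    have "fst (lam t) = helix_point z0 (?th (sig t))"
      unfolding eq_helix_point_iff using unit_vector_eq_cos_sin[OF R w] z t by blast
    then show "gam s = helix_point z0 (?th s)" using proj t by simp
  qed
qed
section \<open>Boundary leaves and the helices over them\<close>

lemma DERIV_nth:
  assumes "(c has_vector_derivative v) (at s within T)"
  shows "((\<lambda>s. c s $ i) has_real_derivative v $ i) (at s within T)"
  using bounded_linear.has_vector_derivative[OF bounded_linear_vec_nth assms]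
  by (simp add: has_real_derivative_iff_has_vector_derivative)

lemma has_vector_derivative_vector_3:
  assumes "(f has_real_derivative f') F" "(g has_real_derivative g') F" "(h has_real_derivative h') F"
    and F: "F = at s within T"
  shows "((\<lambda>s. vector [f s, g s, h s] :: real^3) has_vector_derivative vector [f', g', h']) F"
proof -
  have vec: "(vector [x, y, z] :: real^3) = x *\<^sub>R axis 1 1 + y *\<^sub>R axis 2 1 + z *\<^sub>R axis 3 1"
    for x y z :: real
    by (simp add: vec_eq_iff forall_3 axis_def)
  show ?thesis
    unfolding vec F
    by (rule derivative_eq_intros assms[unfolded F] refl | simp)+
qed

lemma cos_sin_scaled: "cos u * (d * cos u) + sin u * (d * sin u) = (d :: real)"
  using sin_cos_squared_add[of u] by algebra

text \<open>The angular derivative of \<open>helix_point\<close>. It spans the line where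
  \<open>xi\<close> meets the tangent plane of the cylinder; at radius 1 the contact condition
  forces the height component 1/2.\<close>

definition helix_tangent :: "real \<Rightarrow> real^3" where
  "helix_tangent th = vector [- sin th, cos th, 1 / 2]"

lemma helix_point_has_vector_derivative:
  assumes "(Th has_real_derivative d) (at s within T)"
  shows "((\<lambda>s. helix_point z0 (Th s)) has_vector_derivative d *\<^sub>R helix_tangent (Th s)) (at s within T)"
proof -
  have "((\<lambda>s. cos (Th s)) has_real_derivative - sin (Th s) * d) (at s within T)"
    "((\<lambda>s. sin (Th s)) has_real_derivative cos (Th s) * d) (at s within T)"
    "((\<lambda>s. z0 + Th s / 2) has_real_derivative 0 + d / 2) (at s within T)"
    by (rule DERIV_chain2[OF DERIV_cos assms] DERIV_chain2[OF DERIV_sin assms]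
      DERIV_add[OF DERIV_const DERIV_cdivide[OF assms]])+
  from has_vector_derivative_vector_3[OF this refl]
  have "((\<lambda>s. helix_point z0 (Th s)) has_vector_derivative
      vector [- sin (Th s) * d, cos (Th s) * d, d / 2]) (at s within T)"
    by (simp add: helix_point_def)
  moreover have "vector [- sin (Th s) * d, cos (Th s) * d, d / 2] = d *\<^sub>R helix_tangent (Th s)"
    by (simp add: helix_tangent_def vec_eq_iff forall_3)
  ultimately show ?thesis by simp
qed

lemma helix_tangent_in_xi: "d *\<^sub>R helix_tangent th \<in> xi (helix_point z0 th)"
  by (simp add: xi_def alpha_def helix_tangent_def cos_sin_scaled)

lemma helix_tangent_in_T_bdry: "d *\<^sub>R helix_tangent th \<in> T_bdry (helix_point z0 th)"
  by (simp add: T_bdry_def helix_tangent_def)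

lemma gnorm_helix_tangent: "gnorm (d *\<^sub>R helix_tangent th) = \<bar>d\<bar>"
proof -
  have "(d * sin th)\<^sup>2 + (d * cos th)\<^sup>2 = d\<^sup>2 * ((sin th)\<^sup>2 + (cos th)\<^sup>2)"
    by (simp add: power_mult_distrib distrib_left del: sin_cos_squared_add)
  then show ?thesis by (simp add: gnorm_def helix_tangent_def)
qed

text \<open>Lying in \<open>xi\<close> and tangent to the cylinder, the velocity is
  \<open>mu (-y, x, 1/2)\<close>, so \<open>mu\<close> is the angular velocity. For an angle
  \<open>Th\<close> with derivative \<open>mu\<close>, the height minus \<open>Th / 2\<close> and
  the planar inner product with the model point are both constant.\<close>

lemma boundary_curve_helix_point:
  assumes T: "convex T" "t0 \<in> T" and start: "c t0 = helix_point z0 (Th t0)"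
    and bdry: "\<And>t. t \<in> T \<Longrightarrow> c t \<in> frontier Z"
    and c: "\<And>t. t \<in> T \<Longrightarrow> (c has_vector_derivative v t) (at t within T)"
    and v: "\<And>t. t \<in> T \<Longrightarrow> v t \<in> xi (c t) \<inter> T_bdry (c t)"
    and Th: "\<And>t. t \<in> T \<Longrightarrow>
      (Th has_real_derivative c t $ 1 * v t $ 2 - c t $ 2 * v t $ 1) (at t within T)"
    and t: "t \<in> T"
  shows "c t = helix_point z0 (Th t)"
proof -
  define mu where "mu t = c t $ 1 * v t $ 2 - c t $ 2 * v t $ 1" for t
  have R: "(c t $ 1)\<^sup>2 + (c t $ 2)\<^sup>2 = 1" if "t \<in> T" for t
    using bdry[OF that] by (simp add: frontier_Z)
  have v12: "v t $ 1 = - mu t * c t $ 2" "v t $ 2 = mu t * c t $ 1" if "t \<in> T" for t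
  proof -
    have "c t $ 1 * v t $ 1 + c t $ 2 * v t $ 2 = 0"
      using v[OF that] by (simp add: T_bdry_def)
    then show "v t $ 1 = - mu t * c t $ 2" "v t $ 2 = mu t * c t $ 1"
      using R[OF that] unfolding mu_def by algebra+
  qed
  have v3: "v t $ 3 = mu t / 2" if "t \<in> T" for t
    using v[OF that] by (simp add: xi_def alpha_def mu_def)
  note Th' = Th[folded mu_def]
  have const: "f t = f t0" if "\<And>t. t \<in> T \<Longrightarrow> (f has_real_derivative 0) (at t within T)" for f
    using has_field_derivative_zero_constant[OF T(1) that] T(2) t by metis
  have "c t $ 3 - Th t / 2 = c t0 $ 3 - Th t0 / 2"
  proof (rule const)
    fix t assume t: "t \<in> T"
    from DERIV_diff[OF DERIV_nth[OF c[OF t], of 3] DERIV_cdivide[OF Th'[OF t], of 2]]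
    show "((\<lambda>t. c t $ 3 - Th t / 2) has_real_derivative 0) (at t within T)"
      by (simp add: v3[OF t])
  qed
  moreover have "c t $ 1 * cos (Th t) + c t $ 2 * sin (Th t)
      = c t0 $ 1 * cos (Th t0) + c t0 $ 2 * sin (Th t0)"
  proof (rule const)
    fix t assume t: "t \<in> T"
    have "((\<lambda>t. cos (Th t)) has_real_derivative - sin (Th t) * mu t) (at t within T)"
      "((\<lambda>t. sin (Th t)) has_real_derivative cos (Th t) * mu t) (at t within T)"
      by (rule DERIV_chain2[OF DERIV_cos Th'[OF t]] DERIV_chain2[OF DERIV_sin Th'[OF t]])+
    from DERIV_add[OF DERIV_mult[OF DERIV_nth[OF c[OF t]] this(1)]
        DERIV_mult[OF DERIV_nth[OF c[OF t]] this(2)]]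
    show "((\<lambda>t. c t $ 1 * cos (Th t) + c t $ 2 * sin (Th t)) has_real_derivative 0) (at t within T)"
      by (rule DERIV_cong) (simp add: v12[OF t] algebra_simps)
  qed
  then have "c t $ 1 * cos (Th t) + c t $ 2 * sin (Th t) = 1"
    by (simp add: start flip: power2_eq_square)
  ultimately show ?thesis
    using unit_vector_eq_cos_sin[OF R[OF t]] by (simp add: eq_helix_point_iff start)
qed

text \<open>Unit speed and tangency to the cylinder leave only the angular velocities 1 and -1, and
  continuity of the velocity prevents a switch between them.\<close>

lemma unit_speed_arc_helix_iff:
  assumes I: "curve_domain I"
  shows "unit_speed_arc (helix 1 z0) I gam \<longleftrightarrow>
    (\<exists>e th0. e\<^sup>2 = 1 \<and> (\<forall>s\<in>I. gam s = helix_point z0 (th0 + e * s)))"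
proof
  assume "unit_speed_arc (helix 1 z0) I gam"
  then obtain v where helix: "\<And>s. s \<in> I \<Longrightarrow> gam s \<in> range (helix_point z0)"
    and cont: "continuous_on I v"
    and gam: "\<And>s. s \<in> I \<Longrightarrow> (gam has_vector_derivative v s) (at s within I)"
    and xi: "\<And>s. s \<in> I \<Longrightarrow> v s \<in> xi (gam s)"
    and speed: "\<And>s. s \<in> I \<Longrightarrow> gnorm (v s) = 1"
    unfolding unit_speed_arc_def helix_1 by blast
  obtain s0 where s0: "s0 \<in> I" using I interior_subset unfolding curve_domain_def by blast
  have R: "(gam s $ 1)\<^sup>2 + (gam s $ 2)\<^sup>2 = 1" if "s \<in> I" for s
    using helix[OF that] by auto
  have conv: "convex I" "connected I"
    using I by (auto simp: curve_domain_def is_interval_convex is_interval_connected)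
  have tangent: "gam s $ 1 * v s $ 1 + gam s $ 2 * v s $ 2 = 0" if s: "s \<in> I" for s
  proof -
    note D = DERIV_nth[OF gam[OF s]]
    have "((\<lambda>s. gam s $ 1 * gam s $ 1 + gam s $ 2 * gam s $ 2) has_real_derivative
        2 * (gam s $ 1 * v s $ 1 + gam s $ 2 * v s $ 2)) (at s within I)"
      by (rule DERIV_cong[OF DERIV_add[OF DERIV_mult[OF D D] DERIV_mult[OF D D]]])
        (simp add: algebra_simps)
    moreover have "((\<lambda>s. gam s $ 1 * gam s $ 1 + gam s $ 2 * gam s $ 2) has_real_derivative 0)
        (at s within I)"
      unfolding has_real_derivative_iff_has_vector_derivative
      by (rule has_vector_derivative_transform[OF s R[unfolded power2_eq_square]
            has_vector_derivative_const])
    \<comment> \<open>A nondegenerate interval has no isolated points, so the derivative within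
      \<open>I\<close> is unique even at its ends.\<close>
    moreover have "at s within I \<noteq> bot"
      using connected_imp_perfect[OF conv(2) s curve_domain_not_singleton[OF I]]
      by (simp add: trivial_limit_within)
    ultimately have "2 * (gam s $ 1 * v s $ 1 + gam s $ 2 * v s $ 2) = 0"
      unfolding has_real_derivative_iff_has_vector_derivative
      by (intro vector_derivative_unique_within)
    then show ?thesis by simp
  qed
  define mu where "mu s = gam s $ 1 * v s $ 2 - gam s $ 2 * v s $ 1" for s
  have mu2: "(mu s)\<^sup>2 = 1" if s: "s \<in> I" for s
  proof -
    have "(v s $ 1)\<^sup>2 + (v s $ 2)\<^sup>2 = 1"
      using speed[OF s] by (simp add: gnorm_def)
    then show ?thesis using R[OF s] tangent[OF s] unfolding mu_def by algebra
  qed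
  have "continuous_on I gam"
    using gam by (rule continuous_on_vector_derivative)
  then have "continuous_on I mu"
    unfolding mu_def by (intro continuous_intros cont)
  \<comment> \<open>A continuous function with finite range on a connected set is constant.\<close>
  moreover have "finite (mu ` I)"
    by (rule finite_subset[of _ "{1, -1}"]) (use mu2 in \<open>auto simp: power2_eq_1_iff\<close>)
  ultimately have "mu constant_on I"
    using continuous_finite_range_constant conv(2) by blast
  then obtain e where e: "\<And>s. s \<in> I \<Longrightarrow> mu s = e" unfolding constant_on_def by blast
  obtain th where th: "gam s0 = helix_point z0 th" using helix[OF s0] by blast
  have "gam s = helix_point z0 (th - e * s0 + e * s)" if s: "s \<in> I" for s
  proof (rule boundary_curve_helix_point[OF conv(1) s0 _ _ gam _ _ s])
    show "((\<lambda>s. th - e * s0 + e * s) has_real_derivative gam t $ 1 * v t $ 2 - gam t $ 2 * v t $ 1)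
        (at t within I)" if "t \<in> I" for t
      using e[OF that] by (auto intro!: derivative_eq_intros simp: mu_def)
    show "v t \<in> xi (gam t) \<inter> T_bdry (gam t)" if "t \<in> I" for t
      using xi[OF that] tangent[OF that] by (simp add: T_bdry_def)
  qed (use th R in \<open>auto simp: frontier_Z\<close>)
  then show "\<exists>e th0. e\<^sup>2 = 1 \<and> (\<forall>s\<in>I. gam s = helix_point z0 (th0 + e * s))"
    using mu2[OF s0] e[OF s0] by blast
next
  assume "\<exists>e th0. e\<^sup>2 = 1 \<and> (\<forall>s\<in>I. gam s = helix_point z0 (th0 + e * s))"
  then obtain e th0 where e: "e\<^sup>2 = 1" and gam: "\<And>s. s \<in> I \<Longrightarrow> gam s = helix_point z0 (th0 + e * s)"
    by blast
  have e1: "\<bar>e\<bar> = 1" using e by (auto simp: power2_eq_1_iff)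
  define v where "v s = e *\<^sub>R helix_tangent (th0 + e * s)" for s
  have v_vec: "v = (\<lambda>s. vector [- e * sin (th0 + e * s), e * cos (th0 + e * s), e / 2])"
    by (simp add: v_def helix_tangent_def vec_eq_iff forall_3 fun_eq_iff)
  have "(v has_vector_derivative vector [- e * (cos (th0 + e * s) * e), e * (- sin (th0 + e * s) * e), 0]) (at s)" for s
    unfolding v_vec
    by (rule has_vector_derivative_vector_3[OF _ _ _ refl]; auto intro!: derivative_eq_intros)
  then have "continuous_on I v"
    by (rule continuous_on_vector_derivative[OF has_vector_derivative_at_within])
  moreover have "(gam has_vector_derivative v s) (at s within I)" if s: "s \<in> I" for s
  proof (rule has_vector_derivative_transform[OF s])
    show "((\<lambda>s. helix_point z0 (th0 + e * s)) has_vector_derivative v s) (at s within I)"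
      unfolding v_def by (rule helix_point_has_vector_derivative) (auto intro!: derivative_eq_intros)
  qed (use gam in simp)
  moreover have "v s \<in> xi (gam s)" "gnorm (v s) = 1" if s: "s \<in> I" for s
    using helix_tangent_in_xi[of e "th0 + e * s" z0]
    by (auto simp: gam[OF s] v_def gnorm_helix_tangent e1)
  ultimately show "unit_speed_arc (helix 1 z0) I gam"
    unfolding unit_speed_arc_def helix_1 using gam by (auto intro!: exI[of _ v])
qed

text \<open>Any two points of the helix are joined by letting the angle vary linearly. Conversely,
  the angle along a curve in the leaf is recovered by integrating its angular velocity.\<close>

lemma leaf_through_helix_point: "leaf_through (helix_point z0 th) = helix 1 z0"
proof
  show "helix 1 z0 \<subseteq> leaf_through (helix_point z0 th)"
  proof
    fix q assume "q \<in> helix 1 z0"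
    then obtain th' where q: "q = helix_point z0 th'" by (auto simp: helix_1)
    define Th where "Th t = th + t * (th' - th)" for t
    let ?c = "\<lambda>t. helix_point z0 (Th t)"
    let ?c' = "\<lambda>t. (th' - th) *\<^sub>R helix_tangent (Th t)"
    have "(helix_tangent has_vector_derivative vector [- cos u, - sin u, 0]) (at u)" for u
      unfolding helix_tangent_def[abs_def]
      by (rule has_vector_derivative_vector_3[OF _ _ _ refl]; auto intro!: derivative_eq_intros)
    then have "continuous_on UNIV helix_tangent"
      by (rule continuous_on_vector_derivative[OF has_vector_derivative_at_within])
    then have "continuous_on {0..1} (\<lambda>t. helix_tangent (Th t))"
      by (rule continuous_on_compose2) (auto simp: Th_def intro!: continuous_intros)
    then have "continuous_on {0..1} ?c'" by (intro continuous_intros)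
    moreover have "(?c has_vector_derivative ?c' t) (at t within {0..1})" for t
      by (rule helix_point_has_vector_derivative) (auto simp: Th_def intro!: derivative_eq_intros)
    moreover have "?c' t \<in> xi (?c t) \<inter> T_bdry (?c t)" for t
      using helix_tangent_in_xi helix_tangent_in_T_bdry by blast
    moreover have "?c 0 = helix_point z0 th" "?c 1 = q" by (simp_all add: Th_def q)
    moreover have "?c ` {0..1} \<subseteq> frontier Z" using helix_point_frontier by blast
    ultimately show "q \<in> leaf_through (helix_point z0 th)"
      unfolding leaf_through_def by (intro CollectI exI[of _ ?c] exI[of _ ?c'] conjI ballI)
  qed
  show "leaf_through (helix_point z0 th) \<subseteq> helix 1 z0"
  proof
    fix q assume "q \<in> leaf_through (helix_point z0 th)"
    then obtain c c' where c01: "c 0 = helix_point z0 th" "c 1 = q"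
      and bdry: "c ` {0..1::real} \<subseteq> frontier Z" and cont: "continuous_on {0..1} c'"
      and c: "\<And>t. t \<in> {0..1} \<Longrightarrow> (c has_vector_derivative c' t) (at t within {0..1})"
      and c': "\<And>t. t \<in> {0..1} \<Longrightarrow> c' t \<in> xi (c t) \<inter> T_bdry (c t)"
      unfolding leaf_through_def by blast
    define mu where "mu t = c t $ 1 * c' t $ 2 - c t $ 2 * c' t $ 1" for t
    define Th where "Th t = th + integral {0..t} mu" for t
    have "continuous_on {0..1} c"
      using c by (rule continuous_on_vector_derivative)
    then have mu: "continuous_on {0..1} mu"
      unfolding mu_def by (intro continuous_intros cont)
    have Th: "(Th has_real_derivative mu t) (at t within {0..1})" if "t \<in> {0..1}" for t
      using integral_has_real_derivative[OF mu that] unfolding Th_def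
      by (auto intro!: derivative_eq_intros)
    have "c 1 = helix_point z0 (Th 1)"
      by (rule boundary_curve_helix_point[of "{0..1}" 0 c z0 Th c'])
        (use c01 bdry c c' Th in \<open>auto simp: Th_def mu_def\<close>)
    then show "q \<in> helix 1 z0" using c01 by (simp add: helix_1)
  qed
qed

lemma boundary_leaves_eq: "boundary_leaves = range (helix 1)"
proof
  show "boundary_leaves \<subseteq> range (helix 1)"
    unfolding boundary_leaves_def
  proof (rule image_subsetI)
    fix q assume "q \<in> frontier Z"
    then obtain th z0 where "q = helix_point z0 th" by (rule frontier_helix_point)
    then show "leaf_through q \<in> range (helix 1)" by (simp add: leaf_through_helix_point)
  qed
  show "range (helix 1) \<subseteq> boundary_leaves"
    unfolding boundary_leaves_def
  proof (rule image_subsetI)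
    show "helix 1 z0 \<in> leaf_through ` frontier Z" for z0
      by (rule image_eqI[where x = "helix_point z0 0"])
        (simp_all add: leaf_through_helix_point helix_point_frontier)
  qed
qed

section \<open>Lifting helices to characteristics\<close>

lemma C0_loc_converges_const:
  assumes "continuous_on I f"
  shows "C0_loc_converges (\<lambda>n. I) (\<lambda>n. f) I f"
  using assms interior_subset[of I] unfolding C0_loc_converges_def
  by (auto intro: uniform_limit_const)

text \<open>The covector with \<open>a = e\<close> makes the \<open>X\<^sub>H\<close>-trajectory project to a circle of radius \<open>1\<close>, so
  that it runs along the boundary without ever reflecting.\<close>

definition helix_lift :: "real \<Rightarrow> real \<Rightarrow> real \<Rightarrow> real \<Rightarrow> cotangent" where
  "helix_lift e th0 z0 s = (helix_point z0 (th0 + e * s),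
     vector [- e * sin (th0 + e * s) / 2, e * cos (th0 + e * s) / 2, e])"

context
  fixes e th0 z0 :: real
  assumes e: "e\<^sup>2 = 1"
begin

lemma coeffs_helix_lift:
  "coeff_a (helix_lift e th0 z0 s) = e"
  "coeff_b (helix_lift e th0 z0 s) = - e * sin (th0 + e * s)"
  "coeff_c (helix_lift e th0 z0 s) = e * cos (th0 + e * s)"
  by (simp_all add: helix_lift_def coeff_a_def coeff_b_def coeff_c_def)

lemma H_helix_lift: "H (helix_lift e th0 z0 s) = 1"
  by (simp add: H_def coeffs_helix_lift power_mult_distrib e)

lemma helix_lift_has_vector_derivative:
  "(helix_lift e th0 z0 has_vector_derivative ham_vf H (helix_lift e th0 z0 s)) (at s within T)"
proof -
  have fst: "((\<lambda>s. helix_point z0 (th0 + e * s)) has_vector_derivative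
      e *\<^sub>R helix_tangent (th0 + e * s)) (at s within T)"
    by (rule helix_point_has_vector_derivative) (auto intro!: derivative_eq_intros)
  have snd: "((\<lambda>s. vector [- e * sin (th0 + e * s) / 2, e * cos (th0 + e * s) / 2, e] :: real^3)
      has_vector_derivative vector [- e * (cos (th0 + e * s) * e) / 2, e * (- sin (th0 + e * s) * e) / 2, 0])
      (at s within T)"
    by (rule has_vector_derivative_vector_3[OF _ _ _ refl]; auto intro!: derivative_eq_intros)
  have "ham_vf H (helix_lift e th0 z0 s) = (e *\<^sub>R helix_tangent (th0 + e * s),
      vector [- e * (cos (th0 + e * s) * e) / 2, e * (- sin (th0 + e * s) * e) / 2, 0])"
    unfolding ham_vf_H[OF H_helix_lift] coeffs_helix_lift
    by (simp add: helix_lift_def helix_tangent_def vec_eq_iff forall_3 cos_sin_scaled)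
  then show ?thesis
    using has_vector_derivative_Pair[OF fst snd] by (simp add: helix_lift_def[abs_def])
qed

lemma lipschitz_helix_lift:
  assumes "convex J"
  shows "4-lipschitz_on J (helix_lift e th0 z0)"
proof (rule bounded_derivative_imp_lipschitz[OF _ assms])
  show "(helix_lift e th0 z0 has_derivative (\<lambda>t. t *\<^sub>R ham_vf H (helix_lift e th0 z0 s))) (at s within J)"
    for s
    using helix_lift_has_vector_derivative by (simp add: has_vector_derivative_def)
  show "onorm (\<lambda>t. t *\<^sub>R ham_vf H (helix_lift e th0 z0 s)) \<le> 4" for s
  proof (rule onorm_le)
    fix t :: real
    have e1: "\<bar>e\<bar> = 1" using e by (auto simp: power2_eq_1_iff)
    let ?v = "ham_vf H (helix_lift e th0 z0 s)" and ?u = "th0 + e * s"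
    have sc: "\<bar>sin ?u\<bar> \<le> 1" "\<bar>cos ?u\<bar> \<le> 1" by simp_all
    have tau1: "tau (helix_lift e th0 z0 s) = e"
      unfolding tau_def coeffs_helix_lift by (simp add: helix_lift_def cos_sin_scaled)
    note comp = ham_vf_H_simps[OF H_helix_lift[of s]]
    have "norm (fst ?v) \<le> \<bar>fst ?v $ 1\<bar> + \<bar>fst ?v $ 2\<bar> + \<bar>fst ?v $ 3\<bar>"
      using norm_le_l1_cart[of "fst ?v"] by (simp add: sum_3)
    moreover have "norm (snd ?v) \<le> \<bar>snd ?v $ 1\<bar> + \<bar>snd ?v $ 2\<bar> + \<bar>snd ?v $ 3\<bar>"
      using norm_le_l1_cart[of "snd ?v"] by (simp add: sum_3)
    moreover have "norm ?v \<le> norm (fst ?v) + norm (snd ?v)"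
      \<comment> \<open>The six components of the velocity are bounded by 1, 1, 1/2, 1/2, 1/2 and 0,
        so the norm is at most 7/2; the constant 4 is a round bound.\<close>
      by (rule norm_Pair_le[of "fst ?v" "snd ?v", simplified])
    ultimately have "norm ?v \<le> 4"
      using sc unfolding comp coeffs_helix_lift tau1 by (simp add: abs_mult e1 del: abs_sin_le_one abs_cos_le_one)
    then show "norm (t *\<^sub>R ?v) \<le> 4 * norm t"
      by (simp add: mult.commute mult_left_mono)
  qed
qed simp

text \<open>The lift follows \<open>X\<^sub>H\<close> at all times and its base has unit speed, so
  arclength is already the parameter and the time change is the identity.\<close>

lemma helix_lift_reduces_to:
  assumes I: "curve_domain I" and gam: "\<And>s. s \<in> I \<Longrightarrow> gam s = helix_point z0 (th0 + e * s)"
  shows "reduces_to G I (helix_lift e th0 z0) I gam (\<lambda>s. s)"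
proof -
  have S: "helix_lift e th0 z0 s \<in> S_over Z" for s
    by (simp add: S_over_def H_helix_lift) (simp add: helix_lift_def Z_def)
  have "convex I" using I by (simp add: curve_domain_def is_interval_convex)
  then have "billiard_characteristic G I (helix_lift e th0 z0)"
    unfolding billiard_characteristic_def B_def
    using I S lipschitz_helix_lift helix_lift_has_vector_derivative by (auto intro!: AE_I2)
  moreover have "arclength (fst \<circ> helix_lift e th0 z0) s t = t - s" if "s \<le> t" for s t
  proof -
    have "gnorm (vector_derivative (fst \<circ> helix_lift e th0 z0) (at u)) = 1" for u
    proof -
      have "((\<lambda>s. helix_point z0 (th0 + e * s)) has_vector_derivative e *\<^sub>R helix_tangent (th0 + e * u)) (at u)"
        by (rule helix_point_has_vector_derivative) (auto intro!: derivative_eq_intros)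
      then have "vector_derivative (fst \<circ> helix_lift e th0 z0) (at u) = e *\<^sub>R helix_tangent (th0 + e * u)"
        by (intro vector_derivative_at) (simp add: helix_lift_def[abs_def] comp_def)
      then show ?thesis using e by (auto simp: gnorm_helix_tangent power2_eq_1_iff)
    qed
    then show ?thesis using that by (simp add: arclength_def)
  qed
  ultimately show ?thesis
    unfolding reduces_to_def arclength_reparam_def using gam by (auto simp: helix_lift_def)
qed

text \<open>The lift is itself a billiard characteristic lying over the boundary, so the constant
  sequence approximates it.\<close>

lemma helix_C1_gliding:
  assumes I: "curve_domain I" and gam: "\<And>s. s \<in> I \<Longrightarrow> gam s = helix_point z0 (th0 + e * s)"
  shows "C1_gliding_trajectory G I gam"
proof -
  have lift: "continuous_on I (helix_lift e th0 z0)"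
    using helix_lift_has_vector_derivative by (rule continuous_on_vector_derivative)
  then have gam_cont: "continuous_on I gam"
    using continuous_on_fst[OF lift] gam by (simp add: helix_lift_def cong: continuous_on_cong)
  have "C1_limit_trajectory G I gam"
    unfolding C1_limit_trajectory_def
  proof (intro conjI exI[of _ "\<lambda>n. I"] exI[of _ "\<lambda>n. gam"] exI[of _ "\<lambda>n. helix_lift e th0 z0"]
      exI[of _ "\<lambda>n s. s"] exI[of _ I] exI[of _ "helix_lift e th0 z0"] exI[of _ "\<lambda>s. s"] allI)
    show "gam ` I \<subseteq> Z" using gam by (auto simp: Z_def)
    show "reduces_to G I (helix_lift e th0 z0) I gam (\<lambda>s. s)"
      by (rule helix_lift_reduces_to[OF I gam])
    show "C0_loc_converges (\<lambda>n. I) (\<lambda>n. helix_lift e th0 z0) I (helix_lift e th0 z0)"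
      by (rule C0_loc_converges_const[OF lift])
  qed (use I gam gam_cont in \<open>auto simp: helix_lift_def intro!: C0_loc_converges_const mono_onI\<close>)
  then show ?thesis
    unfolding C1_gliding_trajectory_def using gam helix_point_frontier by auto
qed

end

section \<open>Gliding trajectories as arcs of boundary leaves\<close>

theorem lemma5p19:
  fixes G :: "real^3 \<Rightarrow> real"
  assumes "table_hamiltonian G"
  shows "(\<forall>I gam. curve_domain I \<longrightarrow>
            (C1_gliding_trajectory G I gam \<longleftrightarrow> (\<exists>z0. unit_speed_arc (helix 1 z0) I gam)))
         \<and> range (helix 1) = boundary_leaves"
proof (intro conjI allI impI)
  fix I gam assume I: "curve_domain I"
  show "C1_gliding_trajectory G I gam \<longleftrightarrow> (\<exists>z0. unit_speed_arc (helix 1 z0) I gam)"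
  proof
    assume "C1_gliding_trajectory G I gam"
    then have bdry: "gam ` I \<subseteq> frontier Z" and lim: "C1_limit_trajectory G I gam"
      unfolding C1_gliding_trajectory_def by simp_all
    from lim obtain In gamn Jn lamn sigs J lam sig where
      red: "\<forall>n. reduces_to G (Jn n) (lamn n) (In n) (gamn n) (sigs n)" and
      J: "curve_domain J" and
      conv: "C0_loc_converges Jn lamn J lam" "C0_loc_converges Jn sigs J sig" and
      sig: "sig ` J = I" and proj: "\<forall>t\<in>J. fst (lam t) = gam (sig t)"
      unfolding C1_limit_trajectory_def by (elim conjE exE) (rule that)
    obtain e th0 z0 where "e\<^sup>2 = 1" "\<And>s. s \<in> I \<Longrightarrow> gam s = helix_point z0 (th0 + e * s)"
      by (rule limit_on_boundary_helix[OF assms red[rule_format] conv J I sig proj[rule_format] bdry],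
          assumption) (rule that)
    then show "\<exists>z0. unit_speed_arc (helix 1 z0) I gam"
      unfolding unit_speed_arc_helix_iff[OF I] by blast
  next
    assume "\<exists>z0. unit_speed_arc (helix 1 z0) I gam"
    then obtain e th0 z0 where "e\<^sup>2 = 1" "\<And>s. s \<in> I \<Longrightarrow> gam s = helix_point z0 (th0 + e * s)"
      unfolding unit_speed_arc_helix_iff[OF I] by blast
    then show "C1_gliding_trajectory G I gam" by (rule helix_C1_gliding[OF _ I])
  qed
qed (simp add: boundary_leaves_eq)

end
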